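(* Let $m,n$ be positive integers, $A \in \mathbb{Z}^{m\times n}$ and $b \in \mathbb{Z}^m$, and suppose that every entry $a_{ij}$ of $A$ satisfies $|a_{ij}| \le \Delta$. There is an algorithm that, in time $(O(m\cdot\Delta))^m \cdot \|b\|_1 \cdot n$, either computes a vector $x \in \mathbb{Z}^n$ with $Ax = b$ and $x \ge 0$, or correctly asserts that no such vector exists.
   Context: $\|b\|_1$ denotes the $\ell_1$-norm of $b$. The notation $O(m\cdot\Delta)^m$ in the paper means $(O(m\cdot \Delta))^m$, i.e. $(C\, m\Delta)^m$ for some absolute constant $C$.
   Formalization: In the time bound, Δ and ‖b‖₁ are replaced by max(1,Δ) and max(1,‖b‖₁), because for b = 0 or Δ = 0 the stated bound is 0 and no algorithm runs in zero steps; time is counted in unit-cost additions, subtractions, comparisons and memory accesses. *)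

theory Defs
  imports Complex_Main "Jordan_Normal_Form.Matrix"
begin

text \<open>
  Model of computation: a random access machine with unit-cost operations, programmed in a
  structured language. A state consists of integer registers and of integer arrays, both addressed
  by name; a program mentions only finitely many names, so these arrays are a constant number of
  unbounded memories with indirect addressing. Arithmetic is restricted to addition and subtraction:
  unit-cost multiplication of unbounded integers would make the machine unreasonably powerful.
\<close>

type_synonym name = string

datatype aexp =
    Num int
  | Reg name
  | Cell name aexp
  | Plus aexp aexp
  | Minus aexp aexp

datatype bexp =
    Less aexp aexp
  | Equal aexp aexp
  | Neg bexp
  | Conj bexp bexp

datatype com =
    SKIP
  | Assign name aexp
  | Store name aexp aexp
  | Seq com com
  | Cond bexp com com
  | While bexp com

record state =
  reg :: "name \<Rightarrow> int"
  mem :: "name \<Rightarrow> int \<Rightarrow> int"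

fun aval :: "aexp \<Rightarrow> state \<Rightarrow> int" where
  "aval (Num k) s = k"
| "aval (Reg r) s = reg s r"
| "aval (Cell a e) s = mem s a (aval e s)"
| "aval (Plus e e') s = aval e s + aval e' s"
| "aval (Minus e e') s = aval e s - aval e' s"

fun bval :: "bexp \<Rightarrow> state \<Rightarrow> bool" where
  "bval (Less e e') s \<longleftrightarrow> aval e s < aval e' s"
| "bval (Equal e e') s \<longleftrightarrow> aval e s = aval e' s"
| "bval (Neg c) s \<longleftrightarrow> \<not> bval c s"
| "bval (Conj c c') s \<longleftrightarrow> bval c s \<and> bval c' s"

fun acost :: "aexp \<Rightarrow> nat" where
  "acost (Num k) = 1"
| "acost (Reg r) = 1"
| "acost (Cell a e) = 1 + acost e"
| "acost (Plus e e') = 1 + acost e + acost e'"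
| "acost (Minus e e') = 1 + acost e + acost e'"

fun bcost :: "bexp \<Rightarrow> nat" where
  "bcost (Less e e') = 1 + acost e + acost e'"
| "bcost (Equal e e') = 1 + acost e + acost e'"
| "bcost (Neg c) = 1 + bcost c"
| "bcost (Conj c c') = 1 + bcost c + bcost c'"

text \<open>
  \<open>exec P s t s'\<close>: started in state \<open>s\<close>, the program \<open>P\<close> halts in state \<open>s'\<close> after exactly \<open>t\<close>
  elementary operations.
\<close>

inductive exec :: "com \<Rightarrow> state \<Rightarrow> nat \<Rightarrow> state \<Rightarrow> bool" where
  Skip: "exec SKIP s 1 s"
| Assign: "exec (Assign r e) s (1 + acost e) (s\<lparr>reg := (reg s)(r := aval e s)\<rparr>)"
| Store: "exec (Store a e e') s (1 + acost e + acost e')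
    (s\<lparr>mem := (mem s)(a := (mem s a)(aval e s := aval e' s))\<rparr>)"
| Seq: "exec P s t s' \<Longrightarrow> exec Q s' t' s'' \<Longrightarrow> exec (Seq P Q) s (t + t') s''"
| CondTrue: "bval c s \<Longrightarrow> exec P s t s' \<Longrightarrow> exec (Cond c P Q) s (1 + bcost c + t) s'"
| CondFalse: "\<not> bval c s \<Longrightarrow> exec Q s t s' \<Longrightarrow> exec (Cond c P Q) s (1 + bcost c + t) s'"
| WhileFalse: "\<not> bval c s \<Longrightarrow> exec (While c P) s (1 + bcost c) s"
| WhileTrue: "bval c s \<Longrightarrow> exec P s t s' \<Longrightarrow> exec (While c P) s' t' s'' \<Longrightarrow>
    exec (While c P) s (1 + bcost c + t + t') s''"

inductive_cases SkipE: "exec SKIP s t s'"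
inductive_cases AssignE: "exec (Assign r e) s t s'"
inductive_cases StoreE: "exec (Store a e e') s t s'"
inductive_cases SeqE: "exec (Seq P Q) s t s'"
inductive_cases CondE: "exec (Cond c P Q) s t s'"
inductive_cases WhileE: "exec (While c P) s t s'"

lemma exec_deterministic:
  assumes "exec P s t s'" and "exec P s u u'"
  shows "t = u \<and> s' = u'"
  using assms
proof (induction arbitrary: u u' rule: exec.induct)
  case (Skip s)
  then show ?case by (elim SkipE) simp
next
  case (Assign r e s)
  then show ?case by (elim AssignE) simp
next
  case (Store a e e' s)
  then show ?case by (elim StoreE) simp
next
  case (Seq P s t s' Q t' s'')
  from Seq.prems obtain v w v' where *: "exec P s v v'" "exec Q v' w u'" "u = v + w"
    by (rule SeqE)
  from Seq.IH(1)[OF *(1)] have "t = v" "s' = v'" by simp_all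
  with Seq.IH(2)[of w u'] * show ?case by simp
next
  case (CondTrue c s P t s' Q)
  from CondTrue.prems CondTrue.hyps obtain v where *: "exec P s v u'" "u = 1 + bcost c + v"
    by (elim CondE) simp_all
  with CondTrue.IH[OF *(1)] show ?case by simp
next
  case (CondFalse c s Q t s' P)
  from CondFalse.prems CondFalse.hyps obtain v where *: "exec Q s v u'" "u = 1 + bcost c + v"
    by (elim CondE) simp_all
  with CondFalse.IH[OF *(1)] show ?case by simp
next
  case (WhileFalse c s P)
  from WhileFalse.prems show ?case by (rule WhileE) (use WhileFalse.hyps in simp_all)
next
  case (WhileTrue c s P t s' t' s'')
  from WhileTrue.prems obtain v w v'
    where *: "exec P s v v'" "exec (While c P) v' w u'" "u = 1 + bcost c + v + w"
    by (rule WhileE) (use WhileTrue.hyps in simp_all)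
  from WhileTrue.IH(1)[OF *(1)] have "t = v" "s' = v'" by simp_all
  with WhileTrue.IH(2)[of w u'] * show ?case by simp
qed

definition feasible_solution :: "int mat \<Rightarrow> int vec \<Rightarrow> int vec \<Rightarrow> bool" where
  "feasible_solution A b x \<longleftrightarrow>
     x \<in> carrier_vec (dim_col A) \<and> A *\<^sub>v x = b \<and> 0\<^sub>v (dim_col A) \<le> x"

text \<open>The matrix is stored row by row, with indices starting from \<open>0\<close>.\<close>

definition initial_state :: "int mat \<Rightarrow> int vec \<Rightarrow> state" where
  "initial_state A b =
     \<lparr>reg = (\<lambda>_. 0)(''m'' := int (dim_row A), ''n'' := int (dim_col A)),
      mem = (\<lambda>_ _. 0)
        (''A'' := (\<lambda>k. if 0 \<le> k \<and> k < int (dim_row A * dim_col A)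
                      then A $$ (nat k div dim_col A, nat k mod dim_col A) else 0),
         ''b'' := (\<lambda>k. if 0 \<le> k \<and> k < int (dim_vec b) then b $ nat k else 0))\<rparr>"

definition output_vec :: "nat \<Rightarrow> state \<Rightarrow> int vec" where
  "output_vec n s = vec n (\<lambda>j. mem s ''x'' (int j))"

text \<open>The register \<open>feasible\<close> holds \<open>1\<close> if the machine claims that the array \<open>x\<close> contains a
  solution, and \<open>0\<close> if it asserts that there is none.\<close>

definition correct_answer :: "int mat \<Rightarrow> int vec \<Rightarrow> state \<Rightarrow> bool" where
  "correct_answer A b s \<longleftrightarrow>
     reg s ''feasible'' = 1 \<and> feasible_solution A b (output_vec (dim_col A) s) \<or>
     reg s ''feasible'' = 0 \<and> (\<nexists>x. feasible_solution A b x)"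

definition l1_norm :: "int vec \<Rightarrow> int" where
  "l1_norm b = (\<Sum>i<dim_vec b. \<bar>b $ i\<bar>)"

end

theory Submission
  imports Defs
begin

text \<open>
  If \<open>Ax = b\<close> has a solution \<open>x \<ge> 0\<close>, write \<open>b\<close> as a sum of \<open>t\<close> columns of \<open>A\<close>. By the Steinitz lemma,
  applied to the columns minus \<open>b/t\<close>, they can be ordered so that all partial sums stay within
  sup-distance \<open>2m\<Delta>\<close> of the segment from \<open>0\<close> to \<open>b\<close>. Hence solvability is reachability of \<open>b\<close> from
  \<open>0\<close> by column steps inside the lattice points of that tube, of which there are
  \<open>(O(m\<Delta>))^m \<parallel>b\<parallel>\<^sub>1\<close>, and breadth-first search decides it.

  The machine cannot multiply, but its memories are indexed by arbitrary integers, so a vector is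
  represented by the single integer having the vector's entries as digits in a large base \<open>B\<close>;
  column steps become additions. The tube is enumerated as the union of boxes around a lattice path
  with \<open>\<parallel>b\<parallel>\<^sub>1 + 1\<close> points that follows the segment.
\<close>

section \<open>The Steinitz lemma\<close>

text \<open>The time bound is linear in \<open>n\<close> and in the norm of \<open>b\<close>, so an
  edge of the search must be tested in constant time, on a machine with neither multiplication nor
  division. Deciding afresh whether a point lies near a rational segment is too expensive; therefore
  the tube is listed in advance and marked in an array indexed by codes, which also merges the
  points shared by several boxes. Scaling by the number \<open>K\<close> of path points removes the
  fractions, and passing from the segment to the path costs two units of radius. Products by
  repeated addition are affordable because one factor is always small. The two answers rest on
  different facts. That no solution is missed follows from the Steinitz bound and the closure of the
  visited set under steps, using that codes are additive. That the output solves the system depends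
  on codes being injective where they are compared, since the search sees codes alone.\<close>

lemma homogeneous_system_nontrivial_solution:
  fixes c :: "nat \<Rightarrow> 'a \<Rightarrow> real"
  assumes "finite F" and "p < card F"
  shows "\<exists>d. (\<exists>f\<in>F. d f \<noteq> 0) \<and> (\<forall>q<p. (\<Sum>f\<in>F. c q f * d f) = 0)"
  using assms
proof (induction p arbitrary: F c)
  case 0
  then obtain f where "f \<in> F" by (metis card.empty equals0I less_irrefl)
  then show ?case by (intro exI[of _ "\<lambda>_. 1"]) auto
next
  case (Suc p)
  show ?case
  proof (cases "\<forall>f\<in>F. c p f = 0")
    case True
    obtain d where d: "\<exists>f\<in>F. d f \<noteq> 0" "\<forall>q<p. (\<Sum>f\<in>F. c q f * d f) = 0"
      using Suc.IH[of F c] Suc.prems by auto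
    with True show ?thesis by (intro exI[of _ d]) (auto simp: less_Suc_eq)
  next
    case False
    then obtain g where g: "g \<in> F" "c p g \<noteq> 0" by auto
    \<comment> \<open>One step of Gaussian elimination: equation \<open>p\<close> is solved for the
      unknown \<open>g\<close> and substituted into the others, leaving \<open>p\<close> equations
      in one unknown less.\<close>
    define c' where "c' q f = c q f - c q g / c p g * c p f" for q f
    have "p < card (F - {g})" using Suc.prems g by simp
    then obtain d where d: "\<exists>f\<in>F - {g}. d f \<noteq> 0"
        "\<forall>q<p. (\<Sum>f\<in>F - {g}. c' q f * d f) = 0"
      using Suc.IH[of "F - {g}" c'] Suc.prems by auto
    define r where "r = (\<Sum>f\<in>F - {g}. c p f * d f)"
    define d' where "d' = d(g := - r / c p g)"
    have split: "(\<Sum>f\<in>F. c q f * d' f) = c q g * (- r / c p g) + (\<Sum>f\<in>F - {g}. c q f * d f)" for q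
      by (subst sum.remove[OF Suc.prems(1) g(1)]) (simp add: d'_def)
    have "(\<Sum>f\<in>F. c q f * d' f) = 0" if "q < Suc p" for q
    proof (cases "q = p")
      case True
      then show ?thesis using g by (simp add: split flip: r_def)
    next
      case False
      with that d(2) have "(\<Sum>f\<in>F - {g}. c' q f * d f) = 0" by auto
      moreover have "(\<Sum>f\<in>F - {g}. c' q f * d f)
          = (\<Sum>f\<in>F - {g}. c q f * d f) - c q g / c p g * r"
        by (simp add: c'_def r_def sum_distrib_left algebra_simps flip: sum_subtractf)
      ultimately show ?thesis by (simp add: split)
    qed
    moreover have "\<exists>f\<in>F. d' f \<noteq> 0" using d(1) by (auto simp: d'_def)
    ultimately show ?thesis by blast
  qed
qed

text \<open>Stop at the first exit time: \<open>r f\<close> is the time at which coordinate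
  \<open>f\<close> reaches a face of the unit cube, and at the minimum \<open>\<theta>\<close> of
  these times all coordinates still lie in the closed cube.\<close>

lemma exists_step_to_boundary:
  fixes \<mu> d :: "'a \<Rightarrow> real"
  assumes "finite F" and \<mu>: "\<forall>f\<in>F. 0 < \<mu> f \<and> \<mu> f < 1" and d: "\<exists>f\<in>F. d f \<noteq> 0"
  shows "\<exists>\<theta>. (\<forall>f\<in>F. 0 \<le> \<mu> f + \<theta> * d f \<and> \<mu> f + \<theta> * d f \<le> 1) \<and>
    (\<exists>f\<in>F. \<mu> f + \<theta> * d f = 0 \<or> \<mu> f + \<theta> * d f = 1)"
proof -
  define r where "r f = (if d f > 0 then (1 - \<mu> f) / d f else \<mu> f / - d f)" for f
  define G where "G = {f \<in> F. d f \<noteq> 0}"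
  have G: "finite G" "G \<noteq> {}" using assms by (auto simp: G_def)
  define \<theta> where "\<theta> = Min (r ` G)"
  have "\<theta> \<in> r ` G" unfolding \<theta>_def using G by (intro Min_in) auto
  then obtain g where g: "g \<in> G" "\<theta> = r g" by auto
  have pos: "r f > 0" if "f \<in> G" for f
    using that \<mu> unfolding r_def G_def by (auto intro!: divide_pos_pos divide_pos_neg simp: not_less less_eq_real_def)
  have \<theta>0: "\<theta> > 0" using pos g by auto
  have le: "\<theta> \<le> r f" if "f \<in> G" for f using that G by (simp add: \<theta>_def)
  have in01: "0 \<le> \<mu> f + \<theta> * d f \<and> \<mu> f + \<theta> * d f \<le> 1" if f: "f \<in> F" for f
  proof -
    consider "d f = 0" | "d f > 0" | "d f < 0" by linarith
    then show ?thesis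
    proof cases
      case 1
      then show ?thesis using \<mu> f by auto
    next
      case 2
      then have "\<theta> \<le> (1 - \<mu> f) / d f" using le[of f] f by (simp add: G_def r_def)
      then have "\<theta> * d f \<le> 1 - \<mu> f" using 2 by (simp add: pos_le_divide_eq)
      moreover have "\<theta> * d f > 0" using 2 \<theta>0 by simp
      ultimately show ?thesis using \<mu> f by force
    next
      case 3
      then have "\<theta> \<le> \<mu> f / - d f" using le[of f] f by (simp add: G_def r_def)
      then have "\<theta> * - d f \<le> \<mu> f" using 3 by (subst (asm) pos_le_divide_eq) auto
      moreover have "\<theta> * d f < 0" using 3 \<theta>0 by (simp add: mult_pos_neg)
      ultimately show ?thesis using \<mu> f by force
    qed
  qed
  have "\<mu> g + \<theta> * d g = 0 \<or> \<mu> g + \<theta> * d g = 1"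
    using g by (auto simp: r_def G_def)
  with in01 g show ?thesis by (auto simp: G_def)
qed

text \<open>A vertex argument: as long as more than \<open>m + 1\<close> weights are fractional, one can move along a
  kernel vector of the \<open>m + 1\<close> constraints; with at most \<open>m + 1\<close> fractional weights, the prescribed
  sum forces some weight to be \<open>0\<close>.\<close>

lemma steinitz_weight_vanishing_somewhere:
  fixes v :: "'a \<Rightarrow> nat \<Rightarrow> real"
  assumes "finite A" and "m < card A"
    and "\<forall>f\<in>A. 0 \<le> \<mu> f \<and> \<mu> f \<le> 1"
    and "sum \<mu> A = real (card A) - real m - 1"
    and "\<forall>i<m. (\<Sum>f\<in>A. \<mu> f * v f i) = 0"
  shows "\<exists>\<mu>. (\<forall>f\<in>A. 0 \<le> \<mu> f \<and> \<mu> f \<le> 1) \<and> sum \<mu> A = real (card A) - real m - 1 \<and>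
    (\<forall>i<m. (\<Sum>f\<in>A. \<mu> f * v f i) = 0) \<and> (\<exists>f\<in>A. \<mu> f = 0)"
  using assms(3-)
proof (induction "card {f \<in> A. 0 < \<mu> f \<and> \<mu> f < 1}" arbitrary: \<mu> rule: less_induct)
  case less
  define F where "F = {f \<in> A. 0 < \<mu> f \<and> \<mu> f < 1}"
  have F: "finite F" "F \<subseteq> A" using assms(1) by (auto simp: F_def)
  show ?case
  proof (cases "\<exists>f\<in>A. \<mu> f = 0")
    case True
    with less.prems show ?thesis by blast
  next
    case False
    then have one: "\<mu> f = 1" if "f \<in> A - F" for f
      using that less.prems(1) unfolding F_def by force
    have "sum \<mu> A = sum \<mu> F + sum \<mu> (A - F)"
      using sum.subset_diff[OF F(2) assms(1), of \<mu>] by simp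
    also have "sum \<mu> (A - F) = real (card A) - real (card F)"
      using one F assms(1) by (simp add: card_Diff_subset card_mono of_nat_diff)
    finally have "sum \<mu> F = real (card F) - real m - 1" using less.prems(2) by simp
    moreover have "sum \<mu> F > 0" if "F \<noteq> {}"
      using that F by (intro sum_pos) (auto simp: F_def)
    \<comment> \<open>The weights outside \<open>F\<close> are all \<open>1\<close> here, so those
      in \<open>F\<close> sum to \<open>card F - m - 1\<close>. This is positive: for empty
      \<open>F\<close> it would be both \<open>0\<close> and negative.\<close>
    ultimately have "Suc m < card F" by (cases "F = {}") auto
    then obtain d where d: "\<exists>f\<in>F. d f \<noteq> 0"
        "\<forall>q<Suc m. (\<Sum>f\<in>F. (if q < m then v f q else 1) * d f) = 0"
      using homogeneous_system_nontrivial_solution[OF F(1), of "Suc m" "\<lambda>q f. if q < m then v f q else 1"]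
      by blast
    obtain \<theta> where \<theta>: "\<forall>f\<in>F. 0 \<le> \<mu> f + \<theta> * d f \<and> \<mu> f + \<theta> * d f \<le> 1"
        "\<exists>f\<in>F. \<mu> f + \<theta> * d f = 0 \<or> \<mu> f + \<theta> * d f = 1"
      using exists_step_to_boundary[OF F(1) _ d(1), of \<mu>] unfolding F_def by auto
    define \<nu> where "\<nu> f = (if f \<in> F then \<mu> f + \<theta> * d f else \<mu> f)" for f
    have \<nu>_sum: "(\<Sum>f\<in>A. \<nu> f * g f) = (\<Sum>f\<in>A. \<mu> f * g f) + \<theta> * (\<Sum>f\<in>F. d f * g f)" for g
    proof -
      have "(\<Sum>f\<in>A. \<nu> f * g f) = (\<Sum>f\<in>A. \<mu> f * g f + (if f \<in> F then \<theta> * (d f * g f) else 0))"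
        by (intro sum.cong) (auto simp: \<nu>_def algebra_simps)
      also have "\<dots> = (\<Sum>f\<in>A. \<mu> f * g f) + (\<Sum>f\<in>F. \<theta> * (d f * g f))"
        using F assms(1) by (simp add: sum.distrib sum.If_cases Int_absorb1)
      finally show ?thesis by (simp add: sum_distrib_left)
    qed
    obtain g where g: "g \<in> F" "\<mu> g + \<theta> * d g = 0 \<or> \<mu> g + \<theta> * d g = 1" using \<theta>(2) by blast
    then have "g \<notin> {f \<in> A. 0 < \<nu> f \<and> \<nu> f < 1}" by (auto simp add: \<nu>_def)
    moreover have "{f \<in> A. 0 < \<nu> f \<and> \<nu> f < 1} \<subseteq> F"
    proof
      fix f assume "f \<in> {f \<in> A. 0 < \<nu> f \<and> \<nu> f < 1}"
      then show "f \<in> F" by (cases "f \<in> F") (auto simp: \<nu>_def, simp add: F_def)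
    qed
    ultimately have "{f \<in> A. 0 < \<nu> f \<and> \<nu> f < 1} \<subset> F" using g(1) by blast
    then have "card {f \<in> A. 0 < \<nu> f \<and> \<nu> f < 1} < card F" using F by (intro psubset_card_mono)
    moreover have "\<forall>f\<in>A. 0 \<le> \<nu> f \<and> \<nu> f \<le> 1" using \<theta>(1) less.prems(1) by (auto simp add: \<nu>_def)
    moreover have "sum \<nu> A = real (card A) - real m - 1"
      using \<nu>_sum[of "\<lambda>_. 1"] d(2)[rule_format, of m] less.prems(2) by simp
    moreover have "\<forall>i<m. (\<Sum>f\<in>A. \<nu> f * v f i) = 0"
    proof (intro allI impI)
      fix i assume "i < m"
      then show "(\<Sum>f\<in>A. \<nu> f * v f i) = 0"
        using \<nu>_sum[of "\<lambda>f. v f i"] d(2)[rule_format, of i] less.prems(3) by (simp add: mult.commute)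
    qed
    ultimately show ?thesis using less.hyps[of \<nu>] unfolding F_def by blast
  qed
qed

text \<open>Weights that cancel the vectors and sum to \<open>card A - m\<close> are a certificate
  for the full sum: it equals the sum of \<open>(1 - \<mu> f) * v f i\<close>, whose coefficients
  lie in the unit interval and add up to \<open>m\<close>. The ordering is built from its end: an
  element of weight \<open>0\<close> comes last, and the other weights certify the rest. With fewer
  than \<open>m\<close> elements the triangle inequality replaces the certificate.\<close>

lemma steinitz_ordering_of_weighted:
  fixes v :: "'a \<Rightarrow> nat \<Rightarrow> real"
  assumes "finite A" and v: "\<And>f i. f \<in> A \<Longrightarrow> i < m \<Longrightarrow> \<bar>v f i\<bar> \<le> M" and "0 \<le> M"
    and "m \<le> card A \<Longrightarrow> (\<forall>f\<in>A. 0 \<le> \<mu> f \<and> \<mu> f \<le> 1) \<and> sum \<mu> A = real (card A) - real m \<and>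
      (\<forall>i<m. (\<Sum>f\<in>A. \<mu> f * v f i) = 0)"
  shows "\<exists>xs. distinct xs \<and> set xs = A \<and>
    (\<forall>l. \<forall>i<m. \<bar>\<Sum>f\<in>set (take l xs). v f i\<bar> \<le> real m * M)"
  using assms
proof (induction "card A" arbitrary: A \<mu>)
  case 0
  then have "A = {}" by simp
  then show ?case using \<open>0 \<le> M\<close> by simp
next
  case (Suc k)
  have bound: "\<bar>\<Sum>f\<in>A. v f i\<bar> \<le> real m * M" if i: "i < m" for i
  proof (cases "m \<le> card A")
    case True
    with Suc.prems(4) have \<mu>: "\<forall>f\<in>A. 0 \<le> \<mu> f \<and> \<mu> f \<le> 1" "sum \<mu> A = real (card A) - real m"
        "(\<Sum>f\<in>A. \<mu> f * v f i) = 0" using i by auto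
    have "(\<Sum>f\<in>A. v f i) = (\<Sum>f\<in>A. (1 - \<mu> f) * v f i)"
      using \<mu>(3) by (simp add: algebra_simps sum_subtractf)
    also have "\<bar>\<dots>\<bar> \<le> (\<Sum>f\<in>A. (1 - \<mu> f) * M)"
      using \<mu>(1) Suc.prems(2) i
      by (intro order_trans[OF sum_abs] sum_mono) (auto simp: abs_mult intro!: mult_mono)
    also have "\<dots> = real m * M"
      using \<mu>(2) by (simp add: sum_subtractf flip: sum_distrib_right)
    finally show ?thesis .
  next
    case False
    have "\<bar>\<Sum>f\<in>A. v f i\<bar> \<le> (\<Sum>f\<in>A. M)"
      using Suc.prems(2) i by (intro order_trans[OF sum_abs] sum_mono) auto
    also have "\<dots> \<le> real m * M" using False Suc.prems(3) by (simp add: mult_right_mono)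
    finally show ?thesis .
  qed
  obtain g \<nu> where g: "g \<in> A" and \<nu>: "m \<le> card (A - {g}) \<Longrightarrow>
      (\<forall>f\<in>A - {g}. 0 \<le> \<nu> f \<and> \<nu> f \<le> 1) \<and> sum \<nu> (A - {g}) = real (card (A - {g})) - real m \<and>
      (\<forall>i<m. (\<Sum>f\<in>A - {g}. \<nu> f * v f i) = 0)"
  proof (cases "m < card A")
    case True
    \<comment> \<open>Scaling by \<open>r\<close> lowers the total weight by one, to the value that
      a certificate for one element less must have.\<close>
    define r where "r = (real (card A) - real m - 1) / (real (card A) - real m)"
    have r: "0 \<le> r" "r \<le> 1" "r * (real (card A) - real m) = real (card A) - real m - 1"
      using True by (auto simp: r_def)
    have \<mu>: "\<forall>f\<in>A. 0 \<le> \<mu> f \<and> \<mu> f \<le> 1" "sum \<mu> A = real (card A) - real m"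
        "\<forall>i<m. (\<Sum>f\<in>A. \<mu> f * v f i) = 0" using True Suc.prems(4) by auto
    have "\<forall>f\<in>A. 0 \<le> r * \<mu> f \<and> r * \<mu> f \<le> 1" using \<mu>(1) r by (auto intro: mult_le_one)
    moreover have "(\<Sum>f\<in>A. r * \<mu> f) = real (card A) - real m - 1"
      using \<mu>(2) r(3) by (simp flip: sum_distrib_left)
    moreover have "\<forall>i<m. (\<Sum>f\<in>A. r * \<mu> f * v f i) = 0"
      using \<mu>(3) by (simp add: mult.assoc flip: sum_distrib_left)
    ultimately obtain \<nu> h where \<nu>: "\<forall>f\<in>A. 0 \<le> \<nu> f \<and> \<nu> f \<le> 1" "sum \<nu> A = real (card A) - real m - 1"
        "\<forall>i<m. (\<Sum>f\<in>A. \<nu> f * v f i) = 0" and h: "h \<in> A" "\<nu> h = 0"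
      using steinitz_weight_vanishing_somewhere[OF Suc.prems(1) True, of "\<lambda>f. r * \<mu> f" v] by blast
    show ?thesis
    proof (rule that[of h \<nu>])
      have "real (card (A - {h})) = real (card A) - 1" using h(1) Suc.hyps(2)[symmetric] Suc.prems(1) by simp
      then show "(\<forall>f\<in>A - {h}. 0 \<le> \<nu> f \<and> \<nu> f \<le> 1) \<and> sum \<nu> (A - {h}) = real (card (A - {h})) - real m \<and>
        (\<forall>i<m. (\<Sum>f\<in>A - {h}. \<nu> f * v f i) = 0)"
        using \<nu> h Suc.prems(1) by (simp add: sum_diff1)
    qed (use h in auto)
  next
    case False
    obtain h where "h \<in> A" using Suc.hyps(2) by fastforce
    moreover have "\<not> m \<le> card (A - {h})" using False Suc.hyps(2) Suc.prems(1) \<open>h \<in> A\<close> by simp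
    ultimately show ?thesis using that[of h] by blast
  qed
  have "k = card (A - {g})" using g Suc.hyps(2) Suc.prems(1) by simp
  from Suc.hyps(1)[OF this _ _ Suc.prems(3) \<nu>] Suc.prems
  obtain xs where xs: "distinct xs" "set xs = A - {g}"
      "\<forall>l. \<forall>i<m. \<bar>\<Sum>f\<in>set (take l xs). v f i\<bar> \<le> real m * M"
    by auto
  have "\<bar>\<Sum>f\<in>set (take l (xs @ [g])). v f i\<bar> \<le> real m * M" if "i < m" for l i
  proof (cases "l \<le> length xs")
    case True
    then show ?thesis using xs(3) that by simp
  next
    case False
    then have "take l (xs @ [g]) = xs @ [g]" by simp
    moreover have "set (xs @ [g]) = A" using xs(2) g by auto
    ultimately show ?thesis using bound that by metis
  qed
  then show ?case using xs g by (intro exI[of _ "xs @ [g]"]) auto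
qed

theorem steinitz_lemma:
  fixes v :: "'a \<Rightarrow> nat \<Rightarrow> real"
  assumes "finite A" and "\<And>f i. f \<in> A \<Longrightarrow> i < m \<Longrightarrow> \<bar>v f i\<bar> \<le> M" and "0 \<le> M"
    and zero: "\<And>i. i < m \<Longrightarrow> (\<Sum>f\<in>A. v f i) = 0"
  shows "\<exists>xs. distinct xs \<and> set xs = A \<and>
    (\<forall>l. \<forall>i<m. \<bar>\<Sum>f\<in>set (take l xs). v f i\<bar> \<le> real m * M)"
proof (rule steinitz_ordering_of_weighted[OF assms(1-3)])
  \<comment> \<open>Uniform weights start the induction: vectors that sum to zero are cancelled by
    any constant weight.\<close>
  define r where "r = (if card A = 0 then 0 else (real (card A) - real m) / real (card A))"
  assume "m \<le> card A"
  then have "0 \<le> r" "r \<le> 1" "real (card A) * r = real (card A) - real m" by (auto simp: r_def)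
  then show "(\<forall>f\<in>A. 0 \<le> r \<and> r \<le> 1) \<and> (\<Sum>f\<in>A. r) = real (card A) - real m \<and>
      (\<forall>i<m. (\<Sum>f\<in>A. r * v f i) = 0)"
    using zero by (simp flip: sum_distrib_left)
qed auto

section \<open>Walks by columns near the segment, and rounding the segment to a lattice path\<close>

lemma exists_list_of_multiplicities:
  fixes x :: "nat \<Rightarrow> nat"
  shows "\<exists>ys. set ys \<subseteq> {..<n} \<and> (\<forall>f :: nat \<Rightarrow> int. (\<Sum>j\<leftarrow>ys. f j) = (\<Sum>j<n. f j * int (x j)))"
proof (induction n)
  case (Suc n)
  then obtain ys where "set ys \<subseteq> {..<n}" "\<forall>f :: nat \<Rightarrow> int. (\<Sum>j\<leftarrow>ys. f j) = (\<Sum>j<n. f j * int (x j))"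
    by blast
  then show ?case
    by (intro exI[of _ "ys @ replicate (x n) n"]) (auto simp: sum_list_replicate algebra_simps)
qed simp

lemma exists_column_walk_near_segment:
  fixes a :: "nat \<Rightarrow> nat \<Rightarrow> int" and b :: "nat \<Rightarrow> int" and x :: "nat \<Rightarrow> nat"
  assumes x: "\<And>i. i < m \<Longrightarrow> (\<Sum>j<n. a j i * int (x j)) = b i"
    and D: "\<And>i j. i < m \<Longrightarrow> j < n \<Longrightarrow> \<bar>a j i\<bar> \<le> D" and "0 \<le> D"
  shows "\<exists>w. set w \<subseteq> {..<n} \<and> (\<forall>i<m. (\<Sum>j\<leftarrow>w. a j i) = b i) \<and>
    (\<forall>l. \<exists>\<theta>\<ge>0. \<theta> \<le> 1 \<and>
      (\<forall>i<m. \<bar>real_of_int (\<Sum>j\<leftarrow>take l w. a j i) - \<theta> * real_of_int (b i)\<bar> \<le> 2 * real m * real_of_int D))"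
proof -
  obtain ys where ys: "set ys \<subseteq> {..<n}"
      "\<And>f :: nat \<Rightarrow> int. (\<Sum>j\<leftarrow>ys. f j) = (\<Sum>j<n. f j * int (x j))"
    using exists_list_of_multiplicities[of n x] by auto
  define t where "t = length ys"
  have ys_sum: "(\<Sum>p<t. a (ys ! p) i) = b i" if "i < m" for i
    using x[OF that] ys(2)[of "\<lambda>j. a j i"]
    by (simp add: t_def sum_list_sum_nth atLeast0LessThan)
  have ysn: "ys ! p < n" if "p < t" for p using that ys(1) nth_mem unfolding t_def by blast
  \<comment> \<open>As a sum of \<open>t\<close> columns, \<open>b\<close> has an average
    \<open>b / t\<close> bounded by \<open>D\<close> like the columns themselves. The differences
    are thus bounded by \<open>2 * D\<close>, the source of the factor \<open>2\<close> in the
    radius.\<close>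
  have bt: "\<bar>real_of_int (b i)\<bar> \<le> real t * real_of_int D" if "i < m" for i
  proof -
    have "\<bar>b i\<bar> \<le> (\<Sum>p<t. D)"
      unfolding ys_sum[OF that, symmetric]
      using D that ysn by (intro order_trans[OF sum_abs] sum_mono) auto
    then have "real_of_int \<bar>b i\<bar> \<le> real_of_int (int t * D)" by (intro of_int_le_iff[THEN iffD2]) simp
    then show ?thesis by simp
  qed
  define v where "v p i = real_of_int (a (ys ! p) i) - real_of_int (b i) / real t" for p i
  have "\<bar>v p i\<bar> \<le> 2 * real_of_int D" if "p \<in> {..<t}" "i < m" for p i
  proof -
    have "\<bar>real_of_int (b i) / real t\<bar> \<le> real_of_int D"
      using bt[OF that(2)] that(1) by (simp add: abs_divide divide_le_eq mult.commute)
    moreover have "\<bar>real_of_int (a (ys ! p) i)\<bar> \<le> real_of_int D"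
      using D[OF that(2) ysn] that(1) by (metis lessThan_iff of_int_abs of_int_le_iff)
    ultimately show ?thesis unfolding v_def by linarith
  qed
  moreover have "(\<Sum>p<t. v p i) = 0" if "i < m" for i
  proof -
    have "(\<Sum>p<t. v p i) = real_of_int (\<Sum>p<t. a (ys ! p) i) - real t * (real_of_int (b i) / real t)"
      by (simp add: v_def sum_subtractf)
    then show ?thesis using ys_sum[OF that] bt[OF that] by (cases "t = 0") auto
  qed
  ultimately obtain xs where xs: "distinct xs" "set xs = {..<t}"
      and near: "\<forall>l. \<forall>i<m. \<bar>\<Sum>p\<in>set (take l xs). v p i\<bar> \<le> real m * (2 * real_of_int D)"
    using steinitz_lemma[of "{..<t}" m v "2 * real_of_int D"] \<open>0 \<le> D\<close> by auto
  define w where "w = map (\<lambda>p. ys ! p) xs"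
  have len: "length xs = t" using distinct_card[OF xs(1)] xs(2) by simp
  have tk: "(\<Sum>j\<leftarrow>take l w. a j i) = (\<Sum>p\<in>set (take l xs). a (ys ! p) i)" for l i
    using xs(1) by (simp add: w_def take_map sum.distinct_set_conv_list comp_def)
  have "set w \<subseteq> {..<n}" using xs(2) ysn by (auto simp: w_def)
  moreover have "(\<Sum>j\<leftarrow>w. a j i) = b i" if "i < m" for i
  proof -
    have "(\<Sum>j\<leftarrow>w. a j i) = (\<Sum>p\<in>set xs. a (ys ! p) i)"
      using tk[where l = "length w" and i = i] by (simp add: w_def)
    then show ?thesis using ys_sum[OF that] xs(2) by simp
  qed
  moreover have "\<exists>\<theta>\<ge>0. \<theta> \<le> 1 \<and>
      (\<forall>i<m. \<bar>real_of_int (\<Sum>j\<leftarrow>take l w. a j i) - \<theta> * real_of_int (b i)\<bar> \<le> 2 * real m * real_of_int D)" for l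
  proof (intro exI conjI allI impI)
    \<comment> \<open>The parameter is the fraction of columns used so far. Counting the set instead
      of taking \<open>l\<close> keeps it at most \<open>1\<close> for \<open>l\<close> beyond the
      length of the walk.\<close>
    let ?\<theta> = "real (card (set (take l xs))) / real t"
    have "card (set (take l xs)) \<le> t" using card_length[of "take l xs"] len by simp
    then show "0 \<le> ?\<theta>" "?\<theta> \<le> 1" by (auto simp: divide_le_eq)
    fix i assume i: "i < m"
    have "(\<Sum>p\<in>set (take l xs). v p i)
        = real_of_int (\<Sum>j\<leftarrow>take l w. a j i) - ?\<theta> * real_of_int (b i)"
      by (simp add: tk v_def sum_subtractf)
    then show "\<bar>real_of_int (\<Sum>j\<leftarrow>take l w. a j i) - ?\<theta> * real_of_int (b i)\<bar> \<le> 2 * real m * real_of_int D"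
      using near i by (metis mult.assoc mult.commute)
  qed
  ultimately show ?thesis by blast
qed

text \<open>Two roundings cost one unit each: replacing \<open>\<theta> * K\<close> by an integer
  \<open>k\<close> at distance at most \<open>1\<close> moves the point by at most
  \<open>\<bar>b i\<bar> / K\<close>, and \<open>p k\<close> differs from \<open>k * b / K\<close>
  by less than \<open>1\<close>. Both are stated after multiplication by \<open>K\<close>.\<close>

lemma near_segment_imp_near_lattice_path:
  fixes y b :: "nat \<Rightarrow> int" and p :: "nat \<Rightarrow> nat \<Rightarrow> int"
  assumes \<theta>: "0 \<le> \<theta>" "\<theta> \<le> 1" and "0 < K"
    and near: "\<And>i. i < m \<Longrightarrow> \<bar>real_of_int (y i) - \<theta> * real_of_int (b i)\<bar> \<le> real_of_int r"
    and b: "\<And>i. i < m \<Longrightarrow> \<bar>b i\<bar> \<le> int K"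
    and p: "\<And>k i. k < K \<Longrightarrow> i < m \<Longrightarrow> \<bar>int k * b i - p k i * int K\<bar> < int K"
  shows "\<exists>k<K. \<forall>i<m. \<bar>y i - p k i\<bar> \<le> r + 2"
proof -
  \<comment> \<open>The minimum takes effect only for \<open>\<theta> = 1\<close>: the floor is then
    \<open>K\<close>, one more than the last index of the path.\<close>
  define k where "k = min (nat \<lfloor>\<theta> * real K\<rfloor>) (K - 1)"
  have "k < K" using \<open>0 < K\<close> by (auto simp: k_def)
  have "\<theta> * real K \<le> real K" using \<theta> by (simp add: mult_left_le_one_le)
  then have k: "\<bar>\<theta> * real K - real k\<bar> \<le> 1"
  proof (cases "nat \<lfloor>\<theta> * real K\<rfloor> \<le> K - 1")
    case True
    moreover have "0 \<le> \<theta> * real K" using \<theta> by simp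
    ultimately show ?thesis unfolding k_def by (simp add: min_absorb1) linarith
  next
    case False
    then have "real k = real K - 1" using \<open>0 < K\<close> by (simp add: k_def of_nat_diff)
    moreover have "int K \<le> \<lfloor>\<theta> * real K\<rfloor>" using False by linarith
    then have "real K \<le> \<theta> * real K" by (simp add: le_floor_iff)
    ultimately show ?thesis using \<open>\<theta> * real K \<le> real K\<close> by linarith
  qed
  have "\<bar>y i - p k i\<bar> \<le> r + 2" if i: "i < m" for i
  proof -
    have "\<bar>real_of_int (b i)\<bar> \<le> real K" using b[OF i] by linarith
    then have "\<bar>(\<theta> * real K - real k) * real_of_int (b i)\<bar> \<le> 1 * real K"
      unfolding abs_mult using k by (intro mult_mono) auto
    moreover have "\<bar>real_of_int (int k * b i - p k i * int K)\<bar> \<le> real K"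
      using p[OF \<open>k < K\<close> i] by linarith
    ultimately have "\<bar>(\<theta> * real_of_int (b i) - real_of_int (p k i)) * real K\<bar> \<le> 2 * real K"
      by (simp add: algebra_simps)
    then have "\<bar>\<theta> * real_of_int (b i) - real_of_int (p k i)\<bar> \<le> 2"
      using \<open>0 < K\<close> by (simp add: abs_mult)
    then show ?thesis using near[OF i] by linarith
  qed
  with \<open>k < K\<close> show ?thesis by blast
qed

section \<open>Positional codes of integer vectors\<close>

text \<open>Digits may be negative and of any size. This makes the code additive without carries;
  injectivity is a matter of small digits.\<close>

definition code :: "int \<Rightarrow> nat \<Rightarrow> (nat \<Rightarrow> int) \<Rightarrow> int" where
  "code B m y = (\<Sum>i<m. y i * B ^ i)"

lemma code_add: "code B m (\<lambda>i. y i + z i) = code B m y + code B m z"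
  by (simp add: code_def algebra_simps sum.distrib)

lemma code_diff: "code B m (\<lambda>i. y i - z i) = code B m y - code B m z"
  by (simp add: code_def algebra_simps sum_subtractf)

lemma code_update_add:
  assumes "i < m"
  shows "code B m (y(i := y i + z)) = code B m y + z * B ^ i"
proof -
  have "y(i := y i + z) = (\<lambda>i'. y i' + (if i' = i then z else 0))" by auto
  then show ?thesis using assms
    by (simp add: code_add) (simp add: code_def if_distrib[of "\<lambda>u. u * _"] cong: if_cong)
qed

text \<open>The lowest digit is divisible by \<open>B\<close> and smaller than \<open>B\<close> in
  absolute value, hence zero; dividing by \<open>B\<close> leaves the code of the remaining
  digits.\<close>

lemma code_eq_0_imp:
  assumes "code B m y = 0" and "\<And>i. i < m \<Longrightarrow> \<bar>y i\<bar> < B" and "i < m"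
  shows "y i = 0"
  using assms
proof (induction m arbitrary: y i)
  case (Suc m)
  have split: "code B (Suc m) y = y 0 + B * code B m (\<lambda>i. y (Suc i))"
    unfolding code_def by (subst sum.lessThan_Suc_shift) (simp add: sum_distrib_left algebra_simps)
  then have "B dvd y 0" using Suc.prems(1) by (metis add_eq_0_iff2 dvd_minus_iff dvd_triv_left)
  then have y0: "y 0 = 0" using Suc.prems(2)[of 0] by (metis abs_of_pos dvd_abs_iff zdvd_not_zless zero_less_Suc zero_less_abs_iff)
  moreover have "B \<noteq> 0" using Suc.prems(2)[of 0] by auto
  ultimately have "code B m (\<lambda>i. y (Suc i)) = 0" using split Suc.prems(1) by simp
  then have "y (Suc i) = 0" if "i < m" for i using Suc.IH[of "\<lambda>i. y (Suc i)" i] Suc.prems(2) that by simp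
  then show ?case using y0 Suc.prems(3) by (cases i) auto
qed simp

lemma code_inject:
  assumes "code B m y = code B m z" and "\<And>i. i < m \<Longrightarrow> \<bar>y i - z i\<bar> < B" and "i < m"
  shows "y i = z i"
  using code_eq_0_imp[of B m "\<lambda>i. y i - z i" i] assms by (simp add: code_diff)

lemma code_Suc: "code B (Suc m) y = code B m y + y m * B ^ m"
  by (simp add: code_def)

lemma code_cong: "(\<And>i. i < m \<Longrightarrow> y i = z i) \<Longrightarrow> code B m y = code B m z"
  by (simp add: code_def)

section \<open>Weakest preconditions with running time\<close>

text \<open>This is total correctness. The rules for loop-free commands are equivalences, for the
  atomic ones thanks to determinism, so the simplifier can run straight-line code symbolically and
  add up its cost.\<close>

definition wp :: "com \<Rightarrow> (nat \<Rightarrow> state \<Rightarrow> bool) \<Rightarrow> state \<Rightarrow> bool" where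
  "wp P Q s \<longleftrightarrow> (\<exists>t s'. exec P s t s' \<and> Q t s')"

lemma wp_mono: "wp P Q s \<Longrightarrow> (\<And>t s'. Q t s' \<Longrightarrow> Q' t s') \<Longrightarrow> wp P Q' s"
  by (auto simp: wp_def)

lemma wp_SKIP [simp]: "wp SKIP Q s \<longleftrightarrow> Q 1 s"
  unfolding wp_def by (metis exec.Skip exec_deterministic)

lemma wp_Assign [simp]:
  "wp (Assign r e) Q s \<longleftrightarrow> Q (1 + acost e) (s\<lparr>reg := (reg s)(r := aval e s)\<rparr>)"
  unfolding wp_def by (metis exec.Assign exec_deterministic)

lemma wp_Store [simp]:
  "wp (Store a e e') Q s \<longleftrightarrow>
    Q (1 + acost e + acost e') (s\<lparr>mem := (mem s)(a := (mem s a)(aval e s := aval e' s))\<rparr>)"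
  unfolding wp_def by (metis exec.Store exec_deterministic)

lemma wp_Seq [simp]:
  "wp (Seq P R) Q s \<longleftrightarrow> wp P (\<lambda>t s'. wp R (\<lambda>t' s''. Q (t + t') s'') s') s"
  by (auto simp: wp_def elim!: SeqE) (blast intro: exec.Seq)+

lemma wp_Cond [simp]:
  "wp (Cond c P R) Q s \<longleftrightarrow>
    (if bval c s then wp P (\<lambda>t. Q (1 + bcost c + t)) s else wp R (\<lambda>t. Q (1 + bcost c + t)) s)"
  by (auto simp: wp_def elim!: CondE)
    (blast intro: exec.CondTrue[simplified] exec.CondFalse[simplified])+

text \<open>The invariant is indexed by the number of iterations; \<open>k < N\<close> under a true
  guard yields both termination and the factor in the time bound. The last
  \<open>1 + bcost c\<close> pays for the failing test.\<close>

lemma wp_While: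
  assumes init: "I 0 s"
    and step: "\<And>k s. I k s \<Longrightarrow> bval c s \<Longrightarrow> k < N \<and> wp P (\<lambda>t s'. t \<le> T \<and> I (Suc k) s') s"
  shows "wp (While c P) (\<lambda>t s'. t \<le> N * (T + 1 + bcost c) + 1 + bcost c \<and>
    (\<exists>k\<le>N. I k s' \<and> \<not> bval c s')) s"
proof -
  have "wp (While c P) (\<lambda>t s'. t \<le> (N - k) * (T + 1 + bcost c) + 1 + bcost c \<and>
    (\<exists>k\<le>N. I k s' \<and> \<not> bval c s')) s" if "I k s" "k \<le> N" for k s
    using that
  proof (induction "N - k" arbitrary: k s)
    case 0
    then have "\<not> bval c s" using step by force
    with 0 show ?case unfolding wp_def using exec.WhileFalse by fastforce
  next
    case (Suc l)
    show ?case
    proof (cases "bval c s")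
      case False
      with Suc show ?thesis unfolding wp_def using exec.WhileFalse by fastforce
    next
      case True
      with step[OF Suc.prems(1)] obtain t s' where 1: "exec P s t s'" "t \<le> T" "I (Suc k) s'" "k < N"
        by (auto simp: wp_def)
      have "l = N - Suc k" using Suc.hyps(2) by simp
      from Suc.hyps(1)[OF this 1(3)] 1(4) obtain t' s'' where 2: "exec (While c P) s' t' s''"
          "t' \<le> (N - Suc k) * (T + 1 + bcost c) + 1 + bcost c" "\<exists>k\<le>N. I k s'' \<and> \<not> bval c s''"
        by (auto simp: wp_def)
      have "N - k = Suc (N - Suc k)" using 1(4) by simp
      then have "1 + bcost c + t + t' \<le> (N - k) * (T + 1 + bcost c) + 1 + bcost c"
        using 1(2) 2(2) by simp
      with exec.WhileTrue[OF True 1(1) 2(1)] 2(3) show ?thesis unfolding wp_def by blast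
    qed
  qed
  from this[OF init] show ?thesis by simp
qed

section \<open>Frame conditions, and rules for counting loops and products\<close>

fun written_regs :: "com \<Rightarrow> name set" where
  "written_regs SKIP = {}"
| "written_regs (Assign r e) = {r}"
| "written_regs (Store a e e') = {}"
| "written_regs (Seq P Q) = written_regs P \<union> written_regs Q"
| "written_regs (Cond c P Q) = written_regs P \<union> written_regs Q"
| "written_regs (While c P) = written_regs P"

fun written_mems :: "com \<Rightarrow> name set" where
  "written_mems SKIP = {}"
| "written_mems (Assign r e) = {}"
| "written_mems (Store a e e') = {a}"
| "written_mems (Seq P Q) = written_mems P \<union> written_mems Q"
| "written_mems (Cond c P Q) = written_mems P \<union> written_mems Q"
| "written_mems (While c P) = written_mems P"

lemma exec_frame:
  assumes "exec P s t s'"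
  shows "(\<forall>r. r \<notin> written_regs P \<longrightarrow> reg s' r = reg s r) \<and>
    (\<forall>a. a \<notin> written_mems P \<longrightarrow> mem s' a = mem s a)"
  using assms by induction auto

definition agree_off :: "com \<Rightarrow> state \<Rightarrow> state \<Rightarrow> bool" where
  "agree_off P s s' \<longleftrightarrow> (\<forall>r. r \<notin> written_regs P \<longrightarrow> reg s' r = reg s r) \<and>
    (\<forall>a. a \<notin> written_mems P \<longrightarrow> mem s' a = mem s a)"

lemma wp_conseq:
  assumes "wp P Q s" and "\<And>t s'. Q t s' \<Longrightarrow> agree_off P s s' \<Longrightarrow> Q' t s'"
  shows "wp P Q' s"
  using assms unfolding wp_def agree_off_def using exec_frame by blast

text \<open>Names that the body does not write keep their values from before the loop, so
  \<open>I\<close> has to describe only what changes.\<close>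

lemma wp_While_frame:
  assumes init: "I 0 s"
    and step: "\<And>k s'. I k s' \<Longrightarrow> agree_off P s s' \<Longrightarrow> bval c s' \<Longrightarrow>
      k < N \<and> wp P (\<lambda>t s''. t \<le> T \<and> I (Suc k) s'') s'"
    and exit: "\<And>t k s'. t \<le> N * (T + 1 + bcost c) + 1 + bcost c \<Longrightarrow> k \<le> N \<Longrightarrow> I k s' \<Longrightarrow>
      agree_off P s s' \<Longrightarrow> \<not> bval c s' \<Longrightarrow> Q t s'"
  shows "wp (While c P) Q s"
proof -
  have "wp (While c P) (\<lambda>t s'. t \<le> N * (T + 1 + bcost c) + 1 + bcost c \<and>
    (\<exists>k\<le>N. (I k s' \<and> agree_off P s s') \<and> \<not> bval c s')) s"
  proof (rule wp_While)
    show "I 0 s \<and> agree_off P s s" using init by (simp add: agree_off_def)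
    fix k s' assume "I k s' \<and> agree_off P s s'" and "bval c s'"
    with step have "k < N" "wp P (\<lambda>t s''. t \<le> T \<and> I (Suc k) s'') s'" by auto
    moreover from this(2) have "wp P (\<lambda>t s''. t \<le> T \<and> I (Suc k) s'' \<and> agree_off P s s'') s'"
      by (rule wp_conseq) (use \<open>I k s' \<and> agree_off P s s'\<close> in \<open>auto simp: agree_off_def\<close>)
    ultimately show "k < N \<and> wp P (\<lambda>t s''. t \<le> T \<and> I (Suc k) s'' \<and> agree_off P s s'') s'" by simp
  qed
  then show ?thesis by (rule wp_mono) (use exit in blast)
qed

text \<open>The summand \<open>4\<close> is the price of one test of the guard. The offset
  \<open>k\<^sub>0\<close> serves loops that extend an already filled part of an array.\<close>

lemma wp_for:
  assumes start: "reg s r = int k\<^sub>0" and bound: "reg s h = int (k\<^sub>0 + N)" and h: "h \<notin> written_regs P"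
    and init: "I 0 s"
    and step: "\<And>k s'. k < N \<Longrightarrow> I k s' \<Longrightarrow> reg s' r = int (k\<^sub>0 + k) \<Longrightarrow> agree_off P s s' \<Longrightarrow>
      wp P (\<lambda>t s''. t \<le> T \<and> reg s'' r = int (k\<^sub>0 + Suc k) \<and> I (Suc k) s'') s'"
    and exit: "\<And>t s'. t \<le> N * (T + 4) + 4 \<Longrightarrow> I N s' \<Longrightarrow> agree_off P s s' \<Longrightarrow> Q t s'"
  shows "wp (While (Less (Reg r) (Reg h)) P) Q s"
proof (rule wp_While_frame[of "\<lambda>k s'. k \<le> N \<and> reg s' r = int (k\<^sub>0 + k) \<and> I k s'" _ _ _ N T])
  show "0 \<le> N \<and> reg s r = int (k\<^sub>0 + 0) \<and> I 0 s" using start init by simp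
next
  fix k s' assume 1: "k \<le> N \<and> reg s' r = int (k\<^sub>0 + k) \<and> I k s'" and fr: "agree_off P s s'"
    and "bval (Less (Reg r) (Reg h)) s'"
  moreover have "reg s' h = int (k\<^sub>0 + N)" using fr bound h by (simp add: agree_off_def)
  ultimately have "k < N" by simp
  moreover have "wp P (\<lambda>t s''. t \<le> T \<and> Suc k \<le> N \<and> reg s'' r = int (k\<^sub>0 + Suc k) \<and> I (Suc k) s'') s'"
    by (rule wp_mono[OF step[OF \<open>k < N\<close>, of s']]) (use 1 fr \<open>k < N\<close> in auto)
  ultimately show "k < N \<and> wp P (\<lambda>t s''. t \<le> T \<and> Suc k \<le> N \<and> reg s'' r = int (k\<^sub>0 + Suc k) \<and> I (Suc k) s'') s'"
    by simp
next
  fix t k s' assume 1: "k \<le> N \<and> reg s' r = int (k\<^sub>0 + k) \<and> I k s'" and fr: "agree_off P s s'"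
    and b: "\<not> bval (Less (Reg r) (Reg h)) s'"
    and t: "t \<le> N * (T + 1 + bcost (Less (Reg r) (Reg h))) + 1 + bcost (Less (Reg r) (Reg h))"
  have "reg s' h = int (k\<^sub>0 + N)" using fr bound h by (simp add: agree_off_def)
  then have "k = N" using 1 b by simp
  then show "Q t s'" using exit[of t s'] 1 t fr by (simp add: algebra_simps)
qed

abbreviation seqs (infixr ";;" 60) where "P ;; Q \<equiv> Seq P Q"
abbreviation assigns (infix "::=" 61) where "r ::= e \<equiv> Assign r e"
abbreviation "incr r \<equiv> Assign r (Plus (Reg r) (Num 1))"

text \<open>Adds \<open>u * v\<close> to \<open>w\<close> by repeated addition, clearing \<open>u\<close>.\<close>

definition multiply :: com where
  "multiply =
    While (Less (Num 0) (Reg ''u''))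
      (''w'' ::= Plus (Reg ''w'') (Reg ''v'') ;; ''u'' ::= Minus (Reg ''u'') (Num 1)) ;;
    While (Less (Reg ''u'') (Num 0))
      (''w'' ::= Minus (Reg ''w'') (Reg ''v'') ;; ''u'' ::= Plus (Reg ''u'') (Num 1))"

text \<open>The cost depends on \<open>u\<close> alone: \<open>12\<close> per iteration and
  \<open>8\<close> for the two failing tests. Callers therefore put the small factor into
  \<open>u\<close> and a power of the base or the length of a list into \<open>v\<close>.\<close>

lemma wp_multiply:
  assumes "\<And>t. t \<le> 12 * nat \<bar>reg s ''u''\<bar> + 8 \<Longrightarrow>
    Q t (s\<lparr>reg := (reg s)(''u'' := 0, ''w'' := reg s ''w'' + reg s ''u'' * reg s ''v'')\<rparr>)"
  shows "wp multiply Q s"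
proof -
  let ?w = "reg s ''w''" and ?u = "reg s ''u''" and ?v = "reg s ''v''"
  define I where "I k s' \<longleftrightarrow> k \<le> nat ?u \<and>
    s' = s\<lparr>reg := (reg s)(''u'' := ?u - int k, ''w'' := ?w + int k * ?v)\<rparr>" for k s'
  \<comment> \<open>The minimum and maximum let one formula describe the start of the second loop
    for either sign of \<open>u\<close>: already \<open>0\<close> after a positive one, untouched
    after a negative one.\<close>
  define J where "J k s' \<longleftrightarrow> k \<le> nat (- ?u) \<and>
    s' = s\<lparr>reg := (reg s)(''u'' := min ?u 0 + int k, ''w'' := ?w + (max ?u 0 - int k) * ?v)\<rparr>" for k s'
  have 1: "I 0 s" by (simp add: I_def)
  have 2: "k < nat ?u \<and> wp (''w'' ::= Plus (Reg ''w'') (Reg ''v'') ;; ''u'' ::= Minus (Reg ''u'') (Num 1))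
      (\<lambda>t s'. t \<le> 8 \<and> I (Suc k) s') s'" if "I k s'" "bval (Less (Num 0) (Reg ''u'')) s'" for k s'
    using that by (auto simp: I_def fun_eq_iff algebra_simps split: if_splits)
  have 3: "J 0 s'" if "I k s'" "\<not> bval (Less (Num 0) (Reg ''u'')) s'" for k s'
  proof -
    have "int k = max ?u 0" using that by (auto simp: I_def)
    then show ?thesis using that(1) by (simp add: I_def J_def min_def max_def)
  qed
  have 4: "k < nat (- ?u) \<and> wp (''w'' ::= Minus (Reg ''w'') (Reg ''v'') ;; ''u'' ::= Plus (Reg ''u'') (Num 1))
      (\<lambda>t s'. t \<le> 8 \<and> J (Suc k) s') s'" if "J k s'" "bval (Less (Reg ''u'') (Num 0)) s'" for k s'
    using that by (auto simp: J_def fun_eq_iff algebra_simps split: if_splits)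
  have 5: "s' = s\<lparr>reg := (reg s)(''u'' := 0, ''w'' := ?w + ?u * ?v)\<rparr>"
    if "J k s'" "\<not> bval (Less (Reg ''u'') (Num 0)) s'" for k s'
  proof -
    have "int k = max (- ?u) 0" using that by (auto simp: J_def min_def split: if_splits)
    then show ?thesis using that(1) by (simp add: J_def min_def max_def split: if_splits)
  qed
  show ?thesis
    unfolding multiply_def wp_Seq
    apply (rule wp_mono[OF wp_While[of I, OF 1 2]], assumption+)
    apply (elim conjE exE)
    apply (rule wp_mono[OF wp_While[of J, OF 3 4]], assumption+)
    apply (elim conjE exE)
    apply (drule (1) 5)
    apply (simp)
    apply (rule assms)
    apply (cases "0 \<le> ?u")
     apply auto
    done
qed

lemma written_multiply [simp]:
  "written_regs multiply = {''u'', ''w''}" "written_mems multiply = {}"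
  by (auto simp: multiply_def)

section \<open>Parameters and codes of the columns\<close>

definition max_entry_step :: com where
  "max_entry_step =
    Cond (Less (Reg ''D'') (Cell ''A'' (Reg ''k''))) (''D'' ::= Cell ''A'' (Reg ''k'')) SKIP ;;
    Cond (Less (Reg ''D'') (Minus (Num 0) (Cell ''A'' (Reg ''k''))))
      (''D'' ::= Minus (Num 0) (Cell ''A'' (Reg ''k''))) SKIP ;;
    incr ''k''"

definition max_entry :: com where
  "max_entry =
    ''u'' ::= Reg ''m'' ;; ''v'' ::= Reg ''n'' ;; ''w'' ::= Num 0 ;; multiply ;;
    ''D'' ::= Num 1 ;; ''k'' ::= Num 0 ;; While (Less (Reg ''k'') (Reg ''w'')) max_entry_step"

text \<open>No bound on the entries is part of the input, so the machine computes one. Since it is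
  \<open>1\<close> or attained by an entry, it is at most \<open>max 1 \<Delta>\<close> for every
  admissible \<open>\<Delta>\<close>.\<close>

lemma wp_max_entry:
  assumes s: "reg s ''m'' = int m" "reg s ''n'' = int n"
    and A: "\<And>k. k < m * n \<Longrightarrow> mem s ''A'' (int k) = A k"
  shows "wp max_entry (\<lambda>t s'. t \<le> 12 * m + 50 * (m * n) + 50 \<and>
    1 \<le> reg s' ''D'' \<and> (\<forall>k<m * n. \<bar>A k\<bar> \<le> reg s' ''D'') \<and>
    (reg s' ''D'' = 1 \<or> (\<exists>k<m * n. reg s' ''D'' = \<bar>A k\<bar>))) s"
  unfolding max_entry_def
  apply simp
  apply (rule wp_multiply)
  apply (simp add: s)
  apply (rule wp_for[where k\<^sub>0 = 0 and N = "m * n" and T = 46 and I = "\<lambda>k s'. 1 \<le> reg s' ''D'' \<and>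
    (\<forall>k'<k. \<bar>A k'\<bar> \<le> reg s' ''D'') \<and>
    (reg s' ''D'' = 1 \<or> (\<exists>k'<m * n. reg s' ''D'' = \<bar>A k'\<bar>))"])
       apply (simp_all add: max_entry_step_def agree_off_def A)
  subgoal premises prems for t k s'
    using prems(2,3) by (auto simp: less_Suc_eq intro: exI[of _ k])
  done

definition one_norm_step :: com where
  "one_norm_step =
    Cond (Less (Cell ''b'' (Reg ''k'')) (Num 0))
      (''K'' ::= Minus (Reg ''K'') (Cell ''b'' (Reg ''k'')))
      (''K'' ::= Plus (Reg ''K'') (Cell ''b'' (Reg ''k''))) ;;
    incr ''k''"

text \<open>The start value \<open>1\<close> keeps the path nonempty for \<open>b = 0\<close> and
  makes \<open>K\<close> exceed every \<open>\<bar>b i\<bar>\<close>.\<close>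

definition one_norm :: com where
  "one_norm = ''K'' ::= Num 1 ;; ''k'' ::= Num 0 ;; While (Less (Reg ''k'') (Reg ''m'')) one_norm_step"

definition parameters :: com where
  "parameters =
    ''u'' ::= Reg ''m'' ;; ''v'' ::= Plus (Reg ''D'') (Reg ''D'') ;; ''w'' ::= Num 2 ;; multiply ;;
    ''R'' ::= Reg ''w'' ;; ''Q'' ::= Plus (Plus (Reg ''R'') (Reg ''R'')) (Num 1) ;;
    ''B'' ::= Plus (Reg ''K'') (Reg ''R'') ;; ''B'' ::= Plus (Reg ''B'') (Reg ''B'') ;;
    ''B'' ::= Plus (Reg ''B'') (Reg ''B'')"

text \<open>Both products share \<open>v\<close>, the current power. Adding \<open>R\<close> times
  it to \<open>off\<close> makes \<open>off\<close> the code of (R, ..., R), and \<open>B\<close>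
  times it is the next power; the cost is linear in \<open>B\<close> and \<open>R\<close>, not in
  the power.\<close>

definition powers_step :: com where
  "powers_step =
    ''v'' ::= Cell ''P'' (Reg ''i'') ;;
    ''u'' ::= Reg ''R'' ;; ''w'' ::= Reg ''off'' ;; multiply ;; ''off'' ::= Reg ''w'' ;;
    ''u'' ::= Reg ''B'' ;; ''w'' ::= Num 0 ;; multiply ;;
    incr ''i'' ;; Store ''P'' (Reg ''i'') (Reg ''w'')"

definition powers :: com where
  "powers =
    ''off'' ::= Num 0 ;; Store ''P'' (Num 0) (Num 1) ;; ''i'' ::= Num 0 ;;
    While (Less (Reg ''i'') (Reg ''m'')) powers_step"

text \<open>Advancing \<open>k\<close> by \<open>n\<close> walks down a column of the row-major
  array without computing a product; \<open>multiply\<close> accumulates the code in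
  \<open>w\<close>.\<close>

definition column_code_step :: com where
  "column_code_step =
    ''u'' ::= Cell ''A'' (Reg ''k'') ;; ''v'' ::= Cell ''P'' (Reg ''i'') ;; multiply ;;
    ''k'' ::= Plus (Reg ''k'') (Reg ''n'') ;; incr ''i''"

definition column_codes_step :: com where
  "column_codes_step =
    ''w'' ::= Num 0 ;; ''k'' ::= Reg ''j'' ;; ''i'' ::= Num 0 ;;
    While (Less (Reg ''i'') (Reg ''m'')) column_code_step ;;
    Store ''ca'' (Reg ''j'') (Reg ''w'') ;; incr ''j''"

definition column_codes :: com where
  "column_codes = ''j'' ::= Num 0 ;; While (Less (Reg ''j'') (Reg ''n'')) column_codes_step"

locale ilp =
  fixes m n D :: nat and A b :: "nat \<Rightarrow> int"
  assumes m: "0 < m" and n: "0 < n" and D: "1 \<le> D" "\<And>k. k < m * n \<Longrightarrow> \<bar>A k\<bar> \<le> int D"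
begin

text \<open>\<open>a j\<close> is the \<open>j\<close>-th column of the matrix stored row by row in \<open>A\<close>. The radius \<open>R\<close> is the Steinitz
  bound \<open>2mD\<close> plus the rounding error \<open>2\<close> of the lattice path, \<open>Q\<close> is the number of lattice points on an
  edge of a box, and \<open>B\<close> is large enough for codes to be injective on the tube and its neighbours.\<close>

definition a :: "nat \<Rightarrow> nat \<Rightarrow> int" where "a j i = A (i * n + j)"
definition K :: nat where "K = 1 + (\<Sum>i<m. nat \<bar>b i\<bar>)"
definition R :: nat where "R = 2 * m * D + 2"
definition Q :: nat where "Q = 2 * R + 1"
definition B :: nat where "B = 4 * (K + R)"

lemma wp_one_norm:
  assumes s: "reg s ''m'' = int m" and b: "\<And>k. k < m \<Longrightarrow> mem s ''b'' (int k) = b k"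
  shows "wp one_norm (\<lambda>t s'. t \<le> 30 * m + 20 \<and> reg s' ''K'' = int K) s"
  unfolding one_norm_def
  apply simp
  apply (rule wp_for[where k\<^sub>0 = 0 and N = m and T = 26 and
    I = "\<lambda>k s'. reg s' ''K'' = 1 + (\<Sum>i<k. \<bar>b i\<bar>)"])
       apply (simp_all add: one_norm_step_def agree_off_def b s K_def)
  done

lemma wp_parameters:
  assumes s: "reg s ''m'' = int m" "reg s ''D'' = int D" "reg s ''K'' = int K"
  shows "wp parameters (\<lambda>t s'. t \<le> 12 * m + 60 \<and> reg s' ''R'' = int R \<and> reg s' ''Q'' = int Q \<and>
    reg s' ''B'' = int B) s"
  unfolding parameters_def
  apply simp
  apply (rule wp_multiply)
  apply (simp add: s R_def Q_def B_def)
  done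

lemma wp_powers:
  assumes s: "reg s ''m'' = int m" "reg s ''R'' = int R" "reg s ''B'' = int B"
  shows "wp powers (\<lambda>t s'. t \<le> m * (70 + 24 * B) + 20 \<and>
    (\<forall>i<m. mem s' ''P'' (int i) = int B ^ i) \<and> reg s' ''off'' = int R * (\<Sum>i<m. int B ^ i)) s"
  unfolding powers_def
  apply simp
  apply (rule wp_for[where k\<^sub>0 = 0 and N = m and T = "24 * B + 66" and
    I = "\<lambda>k s'. (\<forall>i\<le>k. mem s' ''P'' (int i) = int B ^ i) \<and> reg s' ''off'' = int R * (\<Sum>i<k. int B ^ i)"])
       apply (simp_all add: powers_step_def agree_off_def s)
  apply (rule wp_multiply)
  apply simp
  apply (rule wp_multiply)
  apply (simp add: s algebra_simps)
  subgoal premises prems for k s' t t'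
  proof -
    \<comment> \<open>The multipliers of the two products are \<open>R\<close> and \<open>B\<close>,
      so both fit into \<open>24 * B\<close>.\<close>
    have "R \<le> B" by (simp add: B_def)
    moreover have "int i = 1 + int k \<longleftrightarrow> i = Suc k" for i by auto
    ultimately show ?thesis using prems(2,5,6) by (auto simp: le_Suc_eq)
  qed
  done

lemma row_index: "i < m \<Longrightarrow> j < n \<Longrightarrow> i * n + j < m * n"
proof -
  assume "i < m" "j < n"
  then have "i * n + j < Suc i * n" by simp
  also have "\<dots> \<le> m * n" using \<open>i < m\<close> by (intro mult_right_mono) auto
  finally show ?thesis .
qed

lemma a_bound: "i < m \<Longrightarrow> j < n \<Longrightarrow> \<bar>a j i\<bar> \<le> int D"
  unfolding a_def by (intro D row_index)

lemma wp_column_code: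
  assumes s: "reg s ''m'' = int m" "reg s ''n'' = int n" "reg s ''i'' = 0" "reg s ''w'' = 0"
      "reg s ''k'' = int j" and j: "j < n"
    and A: "\<And>k. k < m * n \<Longrightarrow> mem s ''A'' (int k) = A k"
    and P: "\<And>i. i < m \<Longrightarrow> mem s ''P'' (int i) = int B ^ i"
  shows "wp (While (Less (Reg ''i'') (Reg ''m'')) column_code_step)
    (\<lambda>t s'. t \<le> m * (12 * D + 40) + 4 \<and> reg s' ''w'' = code (int B) m (a j)) s"
proof (rule wp_for[where k\<^sub>0 = 0 and N = m and T = "12 * D + 36" and
    I = "\<lambda>i s'. reg s' ''k'' = int (i * n + j) \<and> reg s' ''w'' = code (int B) i (a j)"])
  fix i s' assume i: "i < m" and I: "reg s' ''k'' = int (i * n + j) \<and> reg s' ''w'' = code (int B) i (a j)"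
    and i': "reg s' ''i'' = int (0 + i)" and fr: "agree_off column_code_step s s'"
  have A': "mem s' ''A'' (int (i * n + j)) = a j i" and "reg s' ''n'' = int n" and "mem s' ''P'' (int i) = int B ^ i"
    using fr A[OF row_index[OF i j]] P[OF i] s by (simp_all add: agree_off_def column_code_step_def a_def)
  moreover have "12 * nat \<bar>a j i\<bar> \<le> 12 * D" using a_bound[OF i j] by simp
  ultimately show "wp column_code_step (\<lambda>t s''. t \<le> 12 * D + 36 \<and> reg s'' ''i'' = int (0 + Suc i) \<and>
      reg s'' ''k'' = int (Suc i * n + j) \<and> reg s'' ''w'' = code (int B) (Suc i) (a j)) s'"
    unfolding column_code_step_def using I i'
    apply simp
    apply (rule wp_multiply)
    apply (simp add: code_def del: of_nat_add of_nat_mult)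
    done
qed (use s in \<open>simp_all add: column_code_step_def code_def add.commute\<close>)

lemma wp_column_codes:
  assumes s: "reg s ''m'' = int m" "reg s ''n'' = int n"
    and A: "\<And>k. k < m * n \<Longrightarrow> mem s ''A'' (int k) = A k"
    and P: "\<And>i. i < m \<Longrightarrow> mem s ''P'' (int i) = int B ^ i"
  shows "wp column_codes (\<lambda>t s'. t \<le> n * (40 + m * (12 * D + 40)) + 10 \<and>
    (\<forall>j<n. mem s' ''ca'' (int j) = code (int B) m (a j))) s"
  unfolding column_codes_def
  apply simp
  apply (rule wp_for[where k\<^sub>0 = 0 and N = n and T = "m * (12 * D + 40) + 36" and
    I = "\<lambda>j s'. (\<forall>j'<j. mem s' ''ca'' (int j') = code (int B) m (a j'))"])
       apply (simp_all add: s)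
   apply (simp add: column_codes_step_def column_code_step_def)
  subgoal for j s'
    unfolding column_codes_step_def
    apply simp
    apply (rule wp_conseq, rule wp_column_code[where j = j])
           apply (simp_all add: agree_off_def column_codes_step_def column_code_step_def s A P)
    done
  done

end

section \<open>Enumeration of the tube\<close>

text \<open>A digital line in the manner of Bresenham: the array \<open>e\<close> holds the errors \<open>k b\<^sub>i - K p\<^sub>i\<close> of the current
  point \<open>p\<close>, whose code is \<open>c\<close>. The list \<open>l\<close> receives the corners \<open>p - (R, \<dots>, R)\<close> of the boxes.\<close>

definition path_coordinate_step :: com where
  "path_coordinate_step =
    ''d'' ::= Plus (Cell ''e'' (Reg ''i'')) (Cell ''b'' (Reg ''i'')) ;;
    Cond (Less (Reg ''d'') (Reg ''K''))
      (Cond (Less (Num 0) (Plus (Reg ''d'') (Reg ''K''))) SKIP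
        (''d'' ::= Plus (Reg ''d'') (Reg ''K'') ;; ''c'' ::= Minus (Reg ''c'') (Cell ''P'' (Reg ''i''))))
      (''d'' ::= Minus (Reg ''d'') (Reg ''K'') ;; ''c'' ::= Plus (Reg ''c'') (Cell ''P'' (Reg ''i''))) ;;
    Store ''e'' (Reg ''i'') (Reg ''d'') ;; incr ''i''"

definition path_step :: com where
  "path_step =
    Store ''l'' (Reg ''k'') (Minus (Reg ''c'') (Reg ''off'')) ;; ''i'' ::= Num 0 ;;
    While (Less (Reg ''i'') (Reg ''m'')) path_coordinate_step ;; incr ''k''"

definition path :: com where
  "path = ''c'' ::= Num 0 ;; ''k'' ::= Num 0 ;; While (Less (Reg ''k'') (Reg ''K'')) path_step"

text \<open>For each coordinate, the list is extended by its translates by \<open>1, \<dots>, Q - 1\<close> units.\<close>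

definition fill_step :: com where
  "fill_step =
    Store ''l'' (Reg ''k'') (Plus (Cell ''l'' (Minus (Reg ''k'') (Reg ''L''))) (Cell ''P'' (Reg ''i''))) ;;
    incr ''k''"

definition boxes_step :: com where
  "boxes_step =
    ''u'' ::= Reg ''Q'' ;; ''v'' ::= Reg ''L'' ;; ''w'' ::= Num 0 ;; multiply ;;
    ''k'' ::= Reg ''L'' ;; While (Less (Reg ''k'') (Reg ''w'')) fill_step ;;
    ''L'' ::= Reg ''w'' ;; incr ''i''"

definition boxes :: com where
  "boxes = ''L'' ::= Reg ''K'' ;; ''i'' ::= Num 0 ;; While (Less (Reg ''i'') (Reg ''m'')) boxes_step"

definition mark_step :: com where
  "mark_step = Store ''ok'' (Cell ''l'' (Reg ''k'')) (Num 1) ;; incr ''k''"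

definition mark :: com where
  "mark = ''k'' ::= Num 0 ;; While (Less (Reg ''k'') (Reg ''L'')) mark_step"

text \<open>Entry \<open>k\<close> is entry \<open>k - L\<close> shifted by \<open>P\<close>, so the
  block with number \<open>k div L\<close> is the original list shifted that many times.\<close>

lemma wp_fill:
  assumes s: "reg s ''k'' = int L" "reg s ''L'' = int L" "reg s ''w'' = int (L * Q)"
      "reg s ''i'' = int i" "mem s ''P'' (int i) = P" and L: "0 < L" "0 < Q"
  shows "wp (While (Less (Reg ''k'') (Reg ''w'')) fill_step) (\<lambda>t s'. t \<le> 20 * (L * Q) + 4 \<and>
    (\<forall>k<L * Q. mem s' ''l'' (int k) = mem s ''l'' (int (k mod L)) + int (k div L) * P)) s"
proof -
  have "L \<le> L * Q" using L by simp
  then have LQ: "L + (L * Q - L) = L * Q" by simp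
  show ?thesis
  proof (rule wp_for[where k\<^sub>0 = L and N = "L * Q - L" and T = 16 and
      I = "\<lambda>k s'. \<forall>k'<L + k. mem s' ''l'' (int k') = mem s ''l'' (int (k' mod L)) + int (k' div L) * P"])
    fix k s' assume I: "\<forall>k'<L + k. mem s' ''l'' (int k') = mem s ''l'' (int (k' mod L)) + int (k' div L) * P"
      and k: "reg s' ''k'' = int (L + k)" and fr: "agree_off fill_step s s'"
    have eq: "reg s' ''L'' = int L" "reg s' ''i'' = int i" "mem s' ''P'' (int i) = P"
      using fr s by (simp_all add: agree_off_def fill_step_def)
    have "mem s' ''l'' (int k) = mem s ''l'' (int (k mod L)) + int (k div L) * P" using I L by simp
    then show "wp fill_step (\<lambda>t s''. t \<le> 16 \<and> reg s'' ''k'' = int (L + Suc k) \<and>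
        (\<forall>k'<L + Suc k. mem s'' ''l'' (int k') = mem s ''l'' (int (k' mod L)) + int (k' div L) * P)) s'"
      using I L by (auto simp: fill_step_def eq k less_Suc_eq algebra_simps)
  next
    fix t s' assume t: "t \<le> (L * Q - L) * (16 + 4) + 4" and
      I: "\<forall>k'<L + (L * Q - L). mem s' ''l'' (int k') = mem s ''l'' (int (k' mod L)) + int (k' div L) * P"
    have "(L * Q - L) * (16 + 4) \<le> (L * Q) * 20" by (intro mult_mono) auto
    then have "t \<le> 20 * (L * Q) + 4" using t by linarith
    then show "t \<le> 20 * (L * Q) + 4 \<and>
      (\<forall>k<L * Q. mem s' ''l'' (int k) = mem s ''l'' (int (k mod L)) + int (k div L) * P)"
      using I LQ by simp
  qed (use s LQ in \<open>simp_all add: fill_step_def\<close>)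
qed

lemma exists_less_mult_iff:
  fixes l l' :: "nat \<Rightarrow> int"
  assumes L: "0 < L" and l: "\<forall>k<L * Q. l' k = l (k mod L) + int (k div L) * P"
  shows "(\<exists>k<L * Q. l' k = c) \<longleftrightarrow> (\<exists>q<Q. \<exists>k<L. c = l k + int q * P)"
proof
  assume "\<exists>k<L * Q. l' k = c"
  then obtain k where "k < L * Q" "l' k = c" by blast
  moreover from this have "k div L < Q" "k mod L < L"
    using L by (simp_all add: less_mult_imp_div_less mult.commute)
  ultimately show "\<exists>q<Q. \<exists>k<L. c = l k + int q * P" using l by auto
next
  assume "\<exists>q<Q. \<exists>k<L. c = l k + int q * P"
  then obtain q k where qk: "q < Q" "k < L" "c = l k + int q * P" by blast
  have "q * L + k < Suc q * L" using qk by simp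
  also have "\<dots> \<le> Q * L" using qk by (intro mult_right_mono) auto
  finally have "q * L + k < L * Q" by (simp add: mult.commute)
  moreover from l this have "l' (q * L + k) = c" using qk by simp
  ultimately show "\<exists>k<L * Q. l' k = c" by blast
qed

context ilp
begin

lemma b_less_K:
  assumes "i < m"
  shows "\<bar>b i\<bar> < int K"
proof -
  have "nat \<bar>b i\<bar> \<le> (\<Sum>i<m. nat \<bar>b i\<bar>)" using assms by (intro member_le_sum) auto
  then show ?thesis unfolding K_def by linarith
qed

lemma wp_path_coordinates:
  assumes s: "reg s ''m'' = int m" "reg s ''K'' = int K" "reg s ''i'' = 0" "reg s ''c'' = code (int B) m r"
    and e: "\<And>i. i < m \<Longrightarrow> mem s ''e'' (int i) = int k * b i - r i * int K"
    and small: "\<And>i. i < m \<Longrightarrow> \<bar>int k * b i - r i * int K\<bar> < int K"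
    and b: "\<And>k. k < m \<Longrightarrow> mem s ''b'' (int k) = b k"
    and P: "\<And>i. i < m \<Longrightarrow> mem s ''P'' (int i) = int B ^ i"
  shows "wp (While (Less (Reg ''i'') (Reg ''m'')) path_coordinate_step) (\<lambda>t s'. t \<le> m * 54 + 4 \<and>
    (\<exists>r. (\<forall>i<m. mem s' ''e'' (int i) = int (Suc k) * b i - r i * int K \<and>
        \<bar>int (Suc k) * b i - r i * int K\<bar> < int K) \<and>
      reg s' ''c'' = code (int B) m r)) s"
proof -
  \<comment> \<open>Coordinates below \<open>i\<close> already carry the errors of point
    \<open>Suc k\<close>, the others still those of point \<open>k\<close>. The hybrid point
    \<open>r\<close> is existential because the machine stores only its code.\<close>
  define I where "I i s' \<longleftrightarrow> (\<exists>r. (\<forall>i'<m. mem s' ''e'' (int i') = int (if i' < i then Suc k else k) * b i' - r i' * int K \<and>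
      \<bar>int (if i' < i then Suc k else k) * b i' - r i' * int K\<bar> < int K) \<and>
    reg s' ''c'' = code (int B) m r)" for i and s' :: state
  show ?thesis
  proof (rule wp_for[where k\<^sub>0 = 0 and N = m and T = 50 and I = I])
    show "I 0 s" unfolding I_def using s e small by auto
    fix i s' assume i: "i < m" and "I i s'" and i': "reg s' ''i'' = int (0 + i)"
      and fr: "agree_off path_coordinate_step s s'"
    then obtain r where r: "\<And>i'. i' < m \<Longrightarrow> mem s' ''e'' (int i') = int (if i' < i then Suc k else k) * b i' - r i' * int K"
        "\<And>i'. i' < m \<Longrightarrow> \<bar>int (if i' < i then Suc k else k) * b i' - r i' * int K\<bar> < int K"
      and c: "reg s' ''c'' = code (int B) m r" unfolding I_def by auto
    have eq: "reg s' ''K'' = int K" "mem s' ''b'' (int i) = b i" "mem s' ''P'' (int i) = int B ^ i"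
      using fr s i b P by (simp_all add: agree_off_def path_coordinate_step_def)
    define d where "d = int (Suc k) * b i - r i * int K"
    have e: "mem s' ''e'' (int i) + b i = d" using r(1)[OF i] by (simp add: d_def algebra_simps)
    have "\<bar>d - b i\<bar> < int K" using r(2)[OF i] by (simp add: d_def algebra_simps)
    then have d: "\<bar>d\<bar> < 2 * int K" using b_less_K[OF i] by linarith
    \<comment> \<open>As \<open>d\<close> stays below \<open>2 * K\<close> in absolute value, a
      single correction by \<open>K\<close> restores the bound on the error, and coordinate
      \<open>i\<close> moves by at most one unit.\<close>
    define z where "z = (if int K \<le> d then 1 else if d \<le> - int K then -1 else 0 :: int)"
    let ?r = "r(i := r i + z)"
    have z: "\<bar>d - z * int K\<bar> < int K" using d by (auto simp: z_def)
    have "wp path_coordinate_step (\<lambda>t s''. t \<le> 50 \<and> reg s'' ''i'' = int (0 + Suc i) \<and>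
        reg s'' ''c'' = code (int B) m ?r \<and> mem s'' ''e'' = (mem s' ''e'')(int i := d - z * int K)) s'"
      unfolding path_coordinate_step_def using e eq i' c
      by (simp add: code_update_add[OF i] z_def)
    then show "wp path_coordinate_step (\<lambda>t s''. t \<le> 50 \<and> reg s'' ''i'' = int (0 + Suc i) \<and> I (Suc i) s'') s'"
    proof (rule wp_mono, goal_cases)
      case (1 t s'')
      have "mem s'' ''e'' (int i') = int (if i' < Suc i then Suc k else k) * b i' - ?r i' * int K \<and>
        \<bar>int (if i' < Suc i then Suc k else k) * b i' - ?r i' * int K\<bar> < int K" if "i' < m" for i'
      proof (cases "i' = i")
        case True
        have "d - z * int K = int (Suc k) * b i - ?r i * int K" by (simp add: d_def algebra_simps)
        then show ?thesis using 1 z True by simp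
      next
        case False
        then show ?thesis using 1 r[OF that] by (simp add: less_Suc_eq)
      qed
      then show ?case unfolding I_def using 1 by blast
    qed
  qed (use s in \<open>auto simp add: path_coordinate_step_def I_def\<close>)
qed

lemma wp_path:
  assumes s: "reg s ''m'' = int m" "reg s ''K'' = int K" "reg s ''off'' = off"
    and e: "\<And>i. i < m \<Longrightarrow> mem s ''e'' (int i) = 0"
    and b: "\<And>k. k < m \<Longrightarrow> mem s ''b'' (int k) = b k"
    and P: "\<And>i. i < m \<Longrightarrow> mem s ''P'' (int i) = int B ^ i"
  shows "wp path (\<lambda>t s'. t \<le> K * (m * 54 + 34) + 10 \<and> reg s' ''c'' = code (int B) m b \<and>
    (\<exists>p. (\<forall>k<K. \<forall>i<m. \<bar>int k * b i - p k i * int K\<bar> < int K) \<and>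
      (\<forall>k<K. mem s' ''l'' (int k) = code (int B) m (p k) - off))) s"
proof -
  define J where "J k p s' \<longleftrightarrow> (\<forall>k'\<le>k. \<forall>i<m. \<bar>int k' * b i - p k' i * int K\<bar> < int K) \<and>
    (\<forall>k'<k. mem s' ''l'' (int k') = code (int B) m (p k') - off) \<and>
    (\<forall>i<m. mem s' ''e'' (int i) = int k * b i - p k i * int K) \<and>
    reg s' ''c'' = code (int B) m (p k)" for k p and s' :: state
  have K: "0 < K" by (simp add: K_def)
  have loop: "wp (While (Less (Reg ''k'') (Reg ''K'')) path_step) (\<lambda>t s'. t \<le> K * (m * 54 + 34) + 4 \<and> (\<exists>p. J K p s')) s'"
    if s': "reg s' ''m'' = int m" "reg s' ''K'' = int K" "reg s' ''off'' = off" "mem s' = mem s"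
      "reg s' ''k'' = 0" "reg s' ''c'' = 0" for s'
  proof (rule wp_for[where k\<^sub>0 = 0 and N = K and T = "m * 54 + 30" and I = "\<lambda>k s'. \<exists>p. J k p s'"])
    show "\<exists>p. J 0 p s'" using s' e K by (intro exI[of _ "\<lambda>_ _. 0"]) (simp add: J_def code_def)
    fix k s'' assume k: "k < K" and "\<exists>p. J k p s''" and k': "reg s'' ''k'' = int (0 + k)"
      and fr: "agree_off path_step s' s''"
    then obtain p where J: "J k p s''" by blast
    have eq: "reg s'' ''m'' = int m" "reg s'' ''K'' = int K" "reg s'' ''off'' = off"
        "mem s'' ''b'' = mem s ''b''" "mem s'' ''P'' = mem s ''P''"
      using fr s' by (simp_all add: agree_off_def path_step_def path_coordinate_step_def)
    show "wp path_step (\<lambda>t s'. t \<le> m * 54 + 30 \<and> reg s' ''k'' = int (0 + Suc k) \<and> (\<exists>p. J (Suc k) p s')) s''"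
      unfolding path_step_def wp_Seq wp_Store wp_Assign
    proof (rule wp_conseq, rule wp_path_coordinates[where r = "p k" and k = k], goal_cases)
      case (9 t s3)
      then obtain r where r: "\<forall>i<m. mem s3 ''e'' (int i) = int (Suc k) * b i - r i * int K \<and>
          \<bar>int (Suc k) * b i - r i * int K\<bar> < int K" and c: "reg s3 ''c'' = code (int B) m r" by blast
      have l: "mem s3 ''l'' = (mem s'' ''l'')(int k := code (int B) m (p k) - off)"
        and k3: "reg s3 ''k'' = int k"
        using 9 J k' eq by (simp_all add: agree_off_def path_coordinate_step_def J_def)
      have "J (Suc k) (p(Suc k := r)) (s3\<lparr>reg := (reg s3)(''k'' := int (Suc k))\<rparr>)"
        using J r l c by (simp add: J_def le_Suc_eq less_Suc_eq)
      then show ?case using 9 k3 by (auto simp: algebra_simps)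
    qed (use J eq b P in \<open>simp_all add: J_def\<close>)
  qed (use s' in \<open>auto simp add: path_step_def path_coordinate_step_def algebra_simps\<close>)
  \<comment> \<open>The error of point \<open>K\<close> is a multiple of \<open>K\<close> smaller
    than \<open>K\<close>, hence zero. So \<open>c\<close> ends at the code of \<open>b\<close>,
    where backtracking starts, although the list only contains the points before
    \<open>K\<close>.\<close>
  have end_point: "p K i = b i" if "\<bar>int K * b i - p K i * int K\<bar> < int K" for p :: "nat \<Rightarrow> nat \<Rightarrow> int" and i
  proof -
    have "int K * b i - p K i * int K = (b i - p K i) * int K" by (simp add: algebra_simps)
    with that have "\<bar>b i - p K i\<bar> * int K < 1 * int K" by (simp add: abs_mult)
    then have "\<bar>b i - p K i\<bar> < 1" by (rule mult_right_less_imp_less) simp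
    then show ?thesis by simp
  qed
  show ?thesis
    unfolding path_def wp_Seq wp_Assign
  proof (rule wp_mono[OF loop], goal_cases)
    case (7 t s')
    then obtain p where p: "J K p s'" by blast
    then have "code (int B) m (p K) = code (int B) m b"
      by (intro code_cong end_point) (simp add: J_def)
    with 7 p show ?case by (auto simp: J_def intro!: exI[of _ p])
  qed (simp_all add: s)
qed

text \<open>After \<open>i\<close> rounds the list holds the corners plus all offsets between
  \<open>0\<close> and \<open>2 * R\<close> in the first \<open>i\<close> coordinates. Only
  membership is tracked, since the order is irrelevant and overlapping boxes cause
  repetitions.\<close>

lemma wp_boxes:
  assumes s: "reg s ''m'' = int m" "reg s ''K'' = int K" "reg s ''Q'' = int Q"
    and P: "\<And>i. i < m \<Longrightarrow> mem s ''P'' (int i) = int B ^ i"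
  shows "wp boxes (\<lambda>t s'. t \<le> m * (80 + 12 * Q + 20 * (K * Q ^ m)) + 10 \<and>
    reg s' ''L'' = int (K * Q ^ m) \<and>
    (\<forall>c. (\<exists>k<K * Q ^ m. mem s' ''l'' (int k) = c) \<longleftrightarrow>
      (\<exists>k<K. \<exists>e. (\<forall>i<m. 0 \<le> e i \<and> e i \<le> 2 * int R) \<and>
        c = mem s ''l'' (int k) + code (int B) m e))) s"
proof -
  define I where "I i s' \<longleftrightarrow> reg s' ''L'' = int (K * Q ^ i) \<and>
    (\<forall>c. (\<exists>k<K * Q ^ i. mem s' ''l'' (int k) = c) \<longleftrightarrow>
      (\<exists>k<K. \<exists>e. (\<forall>i'<i. 0 \<le> e i' \<and> e i' \<le> 2 * int R) \<and>
        c = mem s ''l'' (int k) + code (int B) i e))" for i and s' :: state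
  have Q: "0 < Q" by (simp add: Q_def)
  have loop: "wp (While (Less (Reg ''i'') (Reg ''m'')) boxes_step) (\<lambda>t s'. t \<le> m * (80 + 12 * Q + 20 * (K * Q ^ m)) + 4 \<and> I m s') s'"
    if s': "reg s' ''m'' = int m" "reg s' ''Q'' = int Q" "reg s' ''L'' = int K" "reg s' ''i'' = 0" "mem s' = mem s" for s'
  proof (rule wp_for[where k\<^sub>0 = 0 and N = m and T = "76 + 12 * Q + 20 * (K * Q ^ m)" and I = I])
    show "I 0 s'" using s' by (auto simp: I_def code_def)
    fix i s'' assume i: "i < m" and I: "I i s''" and i': "reg s'' ''i'' = int (0 + i)"
      and fr: "agree_off boxes_step s' s''"
    define L where "L = K * Q ^ i"
    have L: "0 < L" "L * Q = K * Q ^ Suc i" using Q by (simp_all add: L_def) (simp add: K_def)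
    \<comment> \<open>Every round is charged the final length of the list. The resulting factor
      \<open>m\<close> is later absorbed by the \<open>m\<close>-th power.\<close>
    have LQ: "L * Q \<le> K * Q ^ m" unfolding L(2) using i Q by (intro mult_left_mono power_increasing) auto
    have eq: "reg s'' ''Q'' = int Q" "reg s'' ''L'' = int L" "mem s'' ''P'' (int i) = int B ^ i"
      using fr s' P[OF i] I by (simp_all add: agree_off_def boxes_step_def fill_step_def I_def L_def)
    show "wp boxes_step (\<lambda>t s'. t \<le> 76 + 12 * Q + 20 * (K * Q ^ m) \<and> reg s' ''i'' = int (0 + Suc i) \<and> I (Suc i) s') s''"
      unfolding boxes_step_def wp_Seq wp_Assign
    proof (rule wp_multiply, rule wp_conseq, rule wp_fill[where L = L and Q = Q and i = i and P = "int B ^ i"], goal_cases)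
      case (8 t\<^sub>1 t\<^sub>2 s3)
      have l: "\<forall>k<L * Q. mem s3 ''l'' (int k) = mem s'' ''l'' (int (k mod L)) + int (k div L) * int B ^ i"
        using 8 by simp
      have r3: "reg s3 ''w'' = int (K * Q ^ Suc i)" "reg s3 ''i'' = int i"
        using 8 eq i' L(2) by (simp_all add: agree_off_def fill_step_def mult.commute flip: of_nat_mult)
      have "(\<exists>k<K * Q ^ Suc i. mem s3 ''l'' (int k) = c) \<longleftrightarrow>
        (\<exists>k<K. \<exists>e. (\<forall>i'<Suc i. 0 \<le> e i' \<and> e i' \<le> 2 * int R) \<and>
          c = mem s ''l'' (int k) + code (int B) (Suc i) e)" (is "_ \<longleftrightarrow> ?r") for c
      proof -
        have "(\<exists>k<L * Q. mem s3 ''l'' (int k) = c) \<longleftrightarrow>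
            (\<exists>q<Q. \<exists>k<L. mem s'' ''l'' (int k) = c - int q * int B ^ i)"
          using exists_less_mult_iff[OF L(1) l] by (auto simp: algebra_simps)
        also have "\<dots> \<longleftrightarrow> (\<exists>q<Q. \<exists>k<K. \<exists>e. (\<forall>i'<i. 0 \<le> e i' \<and> e i' \<le> 2 * int R) \<and>
            c - int q * int B ^ i = mem s ''l'' (int k) + code (int B) i e)"
          using I unfolding I_def L_def by simp
        also have "\<dots> \<longleftrightarrow> ?r"
        proof
          assume "\<exists>q<Q. \<exists>k<K. \<exists>e. (\<forall>i'<i. 0 \<le> e i' \<and> e i' \<le> 2 * int R) \<and>
            c - int q * int B ^ i = mem s ''l'' (int k) + code (int B) i e"
          then obtain q k e where h: "q < Q" "k < K" "\<forall>i'<i. 0 \<le> e i' \<and> e i' \<le> 2 * int R"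
              "c - int q * int B ^ i = mem s ''l'' (int k) + code (int B) i e" by blast
          have "code (int B) i (e(i := int q)) = code (int B) i e" by (rule code_cong) simp
          then show ?r using h by (intro exI[of _ k] conjI exI[of _ "e(i := int q)"])
            (auto simp: less_Suc_eq code_Suc Q_def)
        next
          assume ?r
          then obtain k e where h: "k < K" "\<forall>i'<Suc i. 0 \<le> e i' \<and> e i' \<le> 2 * int R"
              "c = mem s ''l'' (int k) + code (int B) (Suc i) e" by blast
          then have "nat (e i) < Q" "int (nat (e i)) = e i" using h(2) by (auto simp: Q_def nat_less_iff)
          with h show "\<exists>q<Q. \<exists>k<K. \<exists>e. (\<forall>i'<i. 0 \<le> e i' \<and> e i' \<le> 2 * int R) \<and>
            c - int q * int B ^ i = mem s ''l'' (int k) + code (int B) i e"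
            by (intro exI[of _ "nat (e i)"] exI[of _ k] exI[of _ e] conjI) (auto simp: code_Suc)
        qed
        finally show ?thesis unfolding L(2) .
      qed
      then have "I (Suc i) (s3\<lparr>reg := (reg s3)(''L'' := reg s3 ''w'', ''i'' := reg s3 ''i'' + 1)\<rparr>)"
        using r3 by (simp add: I_def)
      then show ?case using 8 r3 LQ eq by simp
    qed (use eq i' L Q in \<open>simp_all add: mult.commute\<close>)
  qed (use s' in \<open>auto simp add: boxes_step_def fill_step_def add.assoc\<close>)
  show ?thesis
    unfolding boxes_def wp_Seq wp_Assign
    by (rule wp_mono[OF loop]) (simp_all add: s I_def)
qed

end

lemma wp_mark:
  assumes s: "reg s ''L'' = int L" "mem s ''ok'' = (\<lambda>_. 0)"
  shows "wp mark (\<lambda>t s'. t \<le> L * 20 + 10 \<and>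
    (\<forall>c. mem s' ''ok'' c = (if \<exists>k<L. mem s ''l'' (int k) = c then 1 else 0))) s"
  unfolding mark_def
  apply simp
  apply (rule wp_for[where k\<^sub>0 = 0 and N = L and T = 16 and
    I = "\<lambda>k s'. \<forall>c. mem s' ''ok'' c = (if \<exists>k'<k. mem s ''l'' (int k') = c then 1 else 0)"])
       apply (simp_all add: s mark_step_def agree_off_def)
  apply (auto simp: less_Suc_eq)
  done

section \<open>Breadth-first search\<close>

text \<open>The array \<open>ok\<close> marks the points of the tube that have not been visited. For a visited point, \<open>par\<close> holds
  the index of the last column plus one; it is \<open>0\<close> for the others, and the origin gets the dummy value \<open>1\<close>.\<close>

definition bfs_edge :: com where
  "bfs_edge =
    ''k'' ::= Plus (Cell ''q'' (Reg ''h'')) (Cell ''ca'' (Reg ''j'')) ;;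
    Cond (Equal (Cell ''ok'' (Reg ''k'')) (Num 1))
      (Store ''ok'' (Reg ''k'') (Num 0) ;; Store ''par'' (Reg ''k'') (Plus (Reg ''j'') (Num 1)) ;;
       Store ''q'' (Reg ''t'') (Reg ''k'') ;; incr ''t'')
      SKIP ;;
    incr ''j''"

definition bfs_step :: com where
  "bfs_step = ''j'' ::= Num 0 ;; While (Less (Reg ''j'') (Reg ''n'')) bfs_edge ;; incr ''h''"

definition bfs :: com where
  "bfs =
    Store ''q'' (Num 0) (Num 0) ;; Store ''ok'' (Num 0) (Num 0) ;; Store ''par'' (Num 0) (Num 1) ;;
    ''h'' ::= Num 0 ;; ''t'' ::= Num 1 ;; While (Less (Reg ''h'') (Reg ''t'')) bfs_step"

definition backtrack_step :: com where
  "backtrack_step =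
    ''j'' ::= Minus (Cell ''par'' (Reg ''c'')) (Num 1) ;;
    Store ''x'' (Reg ''j'') (Plus (Cell ''x'' (Reg ''j'')) (Num 1)) ;;
    ''c'' ::= Minus (Reg ''c'') (Cell ''ca'' (Reg ''j''))"

definition backtrack :: com where
  "backtrack =
    Cond (Equal (Cell ''par'' (Reg ''c'')) (Num 0)) (''feasible'' ::= Num 0)
      (While (Neg (Equal (Reg ''c'') (Num 0))) backtrack_step ;; ''feasible'' ::= Num 1)"

text \<open>Processed entries stay in the queue, so the image of \<open>{..<t}\<close> under
  \<open>q\<close> is the set of visited points. The strict \<open>e' < e\<close> makes backtracking
  terminate; entry \<open>0\<close>, the origin, has no predecessor.\<close>

definition bfs_inv :: "int set \<Rightarrow> (nat \<Rightarrow> int) \<Rightarrow> nat \<Rightarrow> (nat \<Rightarrow> int) \<Rightarrow> nat \<Rightarrow> (int \<Rightarrow> int) \<Rightarrow> (int \<Rightarrow> int) \<Rightarrow> bool"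
  where "bfs_inv S ca n q t ok par \<longleftrightarrow> 0 < t \<and> q 0 = 0 \<and> inj_on q {..<t} \<and> q ` {..<t} \<subseteq> S \<and>
    (\<forall>c. ok c = (if c \<in> S - q ` {..<t} then 1 else 0)) \<and> (\<forall>c. par c \<noteq> 0 \<longleftrightarrow> c \<in> q ` {..<t}) \<and>
    (\<forall>e. 0 < e \<longrightarrow> e < t \<longrightarrow> (\<exists>e'<e. \<exists>j<n. par (q e) = int j + 1 \<and> q e = q e' + ca j))"

lemma bfs_inv_push:
  assumes inv: "bfs_inv S ca n q t ok par" and e: "e < t" "j < n" and k: "k = q e + ca j"
    and new: "k \<in> S" "k \<notin> q ` {..<t}"
  shows "bfs_inv S ca n (q(t := k)) (Suc t) (ok(k := 0)) (par(k := int j + 1))"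
proof -
  let ?q = "q(t := k)"
  have im: "?q ` {..<t} = q ` {..<t}" by auto
  then have im': "?q ` {..<Suc t} = insert k (q ` {..<t})" unfolding lessThan_Suc image_insert by simp
  have "inj_on ?q {..<Suc t}"
    using inv new by (auto simp: bfs_inv_def inj_on_def less_Suc_eq)
  moreover have "\<exists>e'<d. \<exists>j'<n. (par(k := int j + 1)) (?q d) = int j' + 1 \<and> ?q d = ?q e' + ca j'"
    if d: "0 < d" "d < Suc t" for d
  proof (cases "d = t")
    case True
    then show ?thesis using e k by (intro exI[of _ e] exI[of _ j] conjI) auto
  next
    case False
    then have "d < t" using d by simp
    moreover then have "q d \<noteq> k" using new by auto
    moreover obtain e' j' where "e' < d" "j' < n" "par (q d) = int j' + 1" "q d = q e' + ca j'"
      using inv d \<open>d < t\<close> unfolding bfs_inv_def by meson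
    ultimately show ?thesis by (intro exI[of _ e'] exI[of _ j'] conjI) auto
  qed
  moreover have "0 < t" "q 0 = 0" "q ` {..<t} \<subseteq> S" "\<And>c. ok c = (if c \<in> S - q ` {..<t} then 1 else 0)"
      "\<And>c. par c \<noteq> 0 \<longleftrightarrow> c \<in> q ` {..<t}"
    using inv unfolding bfs_inv_def by auto
  ultimately show ?thesis
    unfolding bfs_inv_def im' using new by simp
qed

text \<open>Each point is enqueued at most once; this bounds the number of iterations of the outer
  loop.\<close>

lemma bfs_inv_card:
  assumes "bfs_inv S ca n q t ok par" and "finite S"
  shows "t \<le> card S"
proof -
  have "card (q ` {..<t}) = t" using assms by (simp add: bfs_inv_def card_image)
  moreover have "card (q ` {..<t}) \<le> card S" using assms by (intro card_mono) (auto simp: bfs_inv_def)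
  ultimately show ?thesis by simp
qed

text \<open>The last conjunct says that every step within \<open>S\<close> from a processed entry
  leads to a visited point. Once \<open>h\<close> reaches \<open>t\<close>, the visited set is
  closed.\<close>

definition bfs_state :: "int set \<Rightarrow> (nat \<Rightarrow> int) \<Rightarrow> nat \<Rightarrow> nat \<Rightarrow> nat \<Rightarrow> state \<Rightarrow> bool" where
  "bfs_state S ca n h t s \<longleftrightarrow> reg s ''h'' = int h \<and> reg s ''t'' = int t \<and>
    bfs_inv S ca n (\<lambda>e. mem s ''q'' (int e)) t (mem s ''ok'') (mem s ''par'') \<and>
    (\<forall>e<h. \<forall>j<n. mem s ''q'' (int e) + ca j \<in> S \<longrightarrow>
      mem s ''par'' (mem s ''q'' (int e) + ca j) \<noteq> 0)"

lemma wp_bfs_edge: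
  assumes st: "bfs_state S ca n h t s" and "h < t" and j: "reg s ''j'' = int j" "j < n"
    and ca: "\<And>j. j < n \<Longrightarrow> mem s ''ca'' (int j) = ca j"
    and prev: "\<forall>j'<j. mem s ''q'' (int h) + ca j' \<in> S \<longrightarrow> mem s ''par'' (mem s ''q'' (int h) + ca j') \<noteq> 0"
  shows "wp bfs_edge (\<lambda>t s'. t \<le> 46 \<and> reg s' ''j'' = int (Suc j) \<and>
    (\<exists>t>h. bfs_state S ca n h t s' \<and>
      (\<forall>j'<Suc j. mem s' ''q'' (int h) + ca j' \<in> S \<longrightarrow> mem s' ''par'' (mem s' ''q'' (int h) + ca j') \<noteq> 0))) s"
proof -
  define q where "q e = mem s ''q'' (int e)" for e
  define k where "k = q h + ca j"
  have inv: "bfs_inv S ca n q t (mem s ''ok'') (mem s ''par'')" and r: "reg s ''h'' = int h" "reg s ''t'' = int t"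
    and cl: "\<And>e j. e < h \<Longrightarrow> j < n \<Longrightarrow> q e + ca j \<in> S \<Longrightarrow> mem s ''par'' (q e + ca j) \<noteq> 0"
    and prev': "\<And>j'. j' < j \<Longrightarrow> q h + ca j' \<in> S \<Longrightarrow> mem s ''par'' (q h + ca j') \<noteq> 0"
    using st prev unfolding bfs_state_def q_def by auto
  have ok: "mem s ''ok'' k = 1 \<longleftrightarrow> k \<in> S - q ` {..<t}" and par: "mem s ''par'' k \<noteq> 0 \<longleftrightarrow> k \<in> q ` {..<t}"
    using inv unfolding bfs_inv_def by auto
  have val: "mem s ''q'' (int h) + mem s ''ca'' (int j) = k" using ca[OF j(2)] by (simp add: k_def q_def)
  show ?thesis
  proof (cases "k \<in> S - q ` {..<t}")
    case True
    define s' where "s' = s\<lparr>reg := (reg s)(''k'' := k, ''t'' := int (Suc t), ''j'' := int (Suc j)),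
      mem := (mem s)(''ok'' := (mem s ''ok'')(k := 0), ''par'' := (mem s ''par'')(k := int j + 1),
        ''q'' := (mem s ''q'')(int t := k))\<rparr>"
    have "(\<lambda>e. mem s' ''q'' (int e)) = q(t := k)" by (auto simp: s'_def q_def)
    moreover have "bfs_inv S ca n (q(t := k)) (Suc t) ((mem s ''ok'')(k := 0)) ((mem s ''par'')(k := int j + 1))"
      using bfs_inv_push[OF inv \<open>h < t\<close> j(2) k_def] True by auto
    ultimately have "bfs_state S ca n h (Suc t) s'"
      unfolding bfs_state_def using r cl \<open>h < t\<close> by (simp add: s'_def) (auto simp: q_def)
    moreover have "mem s' ''par'' (mem s' ''q'' (int h) + ca j') \<noteq> 0"
      if "j' < Suc j" "mem s' ''q'' (int h) + ca j' \<in> S" for j'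
      using that prev'[of j'] \<open>h < t\<close> by (auto simp: s'_def k_def q_def less_Suc_eq)
    ultimately have "\<exists>t>h. bfs_state S ca n h t s' \<and>
      (\<forall>j'<Suc j. mem s' ''q'' (int h) + ca j' \<in> S \<longrightarrow> mem s' ''par'' (mem s' ''q'' (int h) + ca j') \<noteq> 0)"
      using \<open>h < t\<close> less_SucI by blast
    moreover have "wp bfs_edge (\<lambda>t s''. t \<le> 46 \<and> reg s'' ''j'' = int (Suc j) \<and> s'' = s') s"
      unfolding bfs_edge_def using True ok by (simp add: j r val s'_def add.commute)
    ultimately show ?thesis by (auto elim: wp_mono)
  next
    case False
    define s' where "s' = s\<lparr>reg := (reg s)(''k'' := k, ''j'' := int (Suc j))\<rparr>"
    have "bfs_state S ca n h t s'" using st by (simp add: bfs_state_def s'_def)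
    moreover have "mem s' ''par'' (mem s' ''q'' (int h) + ca j') \<noteq> 0"
      if "j' < Suc j" "mem s' ''q'' (int h) + ca j' \<in> S" for j'
      using that prev'[of j'] False par by (auto simp: s'_def k_def q_def less_Suc_eq)
    ultimately have "\<exists>t>h. bfs_state S ca n h t s' \<and>
      (\<forall>j'<Suc j. mem s' ''q'' (int h) + ca j' \<in> S \<longrightarrow> mem s' ''par'' (mem s' ''q'' (int h) + ca j') \<noteq> 0)"
      using \<open>h < t\<close> by blast
    moreover have "wp bfs_edge (\<lambda>t s''. t \<le> 46 \<and> reg s'' ''j'' = int (Suc j) \<and> s'' = s') s"
    proof -
      have "mem s ''ok'' k \<noteq> 1" using False ok by blast
      then show ?thesis unfolding bfs_edge_def by (simp add: j r val s'_def add.commute)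
    qed
    ultimately show ?thesis by (auto elim: wp_mono)
  qed
qed

lemma wp_bfs_step:
  assumes st: "bfs_state S ca n h t s" and "h < t" and n: "reg s ''n'' = int n"
    and ca: "\<And>j. j < n \<Longrightarrow> mem s ''ca'' (int j) = ca j"
  shows "wp bfs_step (\<lambda>u s'. u \<le> n * 50 + 12 \<and> (\<exists>t. bfs_state S ca n (Suc h) t s')) s"
  unfolding bfs_step_def wp_Seq wp_Assign
proof (rule wp_for[where k\<^sub>0 = 0 and N = n and T = 46 and I = "\<lambda>j s'. \<exists>t>h. bfs_state S ca n h t s' \<and>
    (\<forall>j'<j. mem s' ''q'' (int h) + ca j' \<in> S \<longrightarrow> mem s' ''par'' (mem s' ''q'' (int h) + ca j') \<noteq> 0)"], goal_cases)
  case (5 j s')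
  then obtain t where "t > h" "bfs_state S ca n h t s'"
      "\<forall>j'<j. mem s' ''q'' (int h) + ca j' \<in> S \<longrightarrow> mem s' ''par'' (mem s' ''q'' (int h) + ca j') \<noteq> 0" by blast
  moreover have "mem s' ''ca'' = mem s ''ca''" using 5 by (simp add: agree_off_def bfs_edge_def)
  ultimately show ?case using wp_bfs_edge[of S ca n h t s' j] 5 ca by simp
next
  case (6 u s')
  then obtain t where t: "t > h" "bfs_state S ca n h t s'" "\<forall>j'<n. mem s' ''q'' (int h) + ca j' \<in> S \<longrightarrow>
      mem s' ''par'' (mem s' ''q'' (int h) + ca j') \<noteq> 0" by blast
  then have "bfs_state S ca n (Suc h) t (s'\<lparr>reg := (reg s')(''h'' := reg s' ''h'' + 1)\<rparr>)"
    by (simp add: bfs_state_def less_Suc_eq)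
  then show ?case using 6(1) by (simp del: ex_simps) blast
qed (use st n \<open>h < t\<close> in \<open>auto simp: bfs_state_def bfs_edge_def\<close>)

lemma wp_bfs:
  assumes n: "reg s ''n'' = int n" and ca: "\<And>j. j < n \<Longrightarrow> mem s ''ca'' (int j) = ca j"
    and ok: "\<And>c. mem s ''ok'' c = (if c \<in> S then 1 else 0)" and par: "mem s ''par'' = (\<lambda>_. 0)"
    and S: "finite S" "card S \<le> L" "0 \<in> S"
  shows "wp bfs (\<lambda>u s'. u \<le> L * (n * 50 + 16) + 30 \<and>
    (\<exists>q t. t \<le> L \<and> bfs_inv S ca n q t (mem s' ''ok'') (mem s' ''par'') \<and>
      (\<forall>e<t. \<forall>j<n. q e + ca j \<in> S \<longrightarrow> mem s' ''par'' (q e + ca j) \<noteq> 0))) s"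
  unfolding bfs_def wp_Seq wp_Assign wp_Store
proof (rule wp_While_frame[where N = L and T = "n * 50 + 12" and I = "\<lambda>h s'. \<exists>t. bfs_state S ca n h t s'"], goal_cases)
  case 1
  have "bfs_inv S ca n (\<lambda>e. ((mem s ''q'')(0 := 0)) (int e)) 1 ((mem s ''ok'')(0 := 0)) ((mem s ''par'')(0 := 1))"
    using S ok by (auto simp: bfs_inv_def par lessThan_Suc)
  then show ?case by (intro exI[of _ 1]) (simp add: bfs_state_def)
next
  case (2 h s')
  then obtain t where st: "bfs_state S ca n h t s'" by blast
  then have "h < t" using 2(3) by (simp add: bfs_state_def)
  moreover have "t \<le> L" using st bfs_inv_card S unfolding bfs_state_def by (meson order_trans)
  moreover have "reg s' ''n'' = int n" "\<And>j. j < n \<Longrightarrow> mem s' ''ca'' (int j) = ca j"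
    using 2(2) n ca by (simp_all add: agree_off_def bfs_step_def bfs_edge_def)
  ultimately show ?case using wp_bfs_step[OF st] by simp
next
  case (3 u h s')
  then obtain t where st: "bfs_state S ca n h t s'" by blast
  then have "t \<le> h" using 3(5) by (simp add: bfs_state_def)
  moreover have "t \<le> L" using st bfs_inv_card S unfolding bfs_state_def by (meson order_trans)
  moreover have "u \<le> L * (n * 50 + 16) + 4" using 3(1) by (simp add: add.commute)
  ultimately show ?case using st unfolding bfs_state_def
    by (intro conjI exI[of _ "\<lambda>e. mem s' ''q'' (int e)"] exI[of _ t]) auto
qed

section \<open>Reading off a solution by backtracking\<close>

lemma sum_mult_update_Suc:
  fixes f :: "nat \<Rightarrow> int"
  assumes "j < n"
  shows "(\<Sum>j'<n. f j' * (x(int j := x (int j) + 1)) (int j')) = (\<Sum>j'<n. f j' * x (int j')) + f j"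
proof -
  have "(\<Sum>j'<n. f j' * (x(int j := x (int j) + 1)) (int j'))
      = (\<Sum>j'<n. f j' * x (int j') + (if j' = j then f j else 0))"
    by (intro sum.cong) (auto simp: algebra_simps)
  then show ?thesis using assms by (simp add: sum.distrib)
qed

context ilp
begin

text \<open>The image of \<open>x\<close> plus the current point \<open>y\<close> stays equal to
  \<open>y\<^sub>0\<close>, while the position in the queue strictly decreases. At code
  \<open>0\<close> the small digits force \<open>y = 0\<close>, so \<open>x\<close> is mapped to
  \<open>y\<^sub>0\<close>.\<close>

lemma wp_backtrack_loop:
  assumes Y: "\<And>y i. y \<in> Y \<Longrightarrow> i < m \<Longrightarrow> \<bar>y i\<bar> \<le> M" and M: "2 * M + int D < int B" "0 \<le> M"
    and inv: "bfs_inv (code (int B) m ` Y) (\<lambda>j. code (int B) m (a j)) n q t ok (mem s ''par'')" and t: "t \<le> L"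
    and c: "reg s ''c'' = code (int B) m y\<^sub>0" "mem s ''par'' (code (int B) m y\<^sub>0) \<noteq> 0"
    and y0: "\<And>i. i < m \<Longrightarrow> \<bar>y\<^sub>0 i\<bar> \<le> M"
    and x: "mem s ''x'' = (\<lambda>_. 0)"
    and ca: "\<And>j. j < n \<Longrightarrow> mem s ''ca'' (int j) = code (int B) m (a j)"
  shows "wp (While (Neg (Equal (Reg ''c'') (Num 0))) backtrack_step) (\<lambda>u s'. u \<le> L * 30 + 10 \<and>
    (\<forall>j. 0 \<le> mem s' ''x'' j) \<and> (\<forall>i<m. (\<Sum>j<n. a j i * mem s' ''x'' (int j)) = y\<^sub>0 i)) s"
proof -
  define I where "I k s' \<longleftrightarrow> (\<forall>j. 0 \<le> mem s' ''x'' j) \<and> (\<exists>e y. e + k < t \<and> q e = code (int B) m y \<and> reg s' ''c'' = q e \<and>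
    (\<forall>i<m. \<bar>y i\<bar> \<le> M) \<and> (\<forall>i<m. (\<Sum>j<n. a j i * mem s' ''x'' (int j)) + y i = y\<^sub>0 i))" for k and s' :: state
  have Bpos: "M < int B" using M by simp
  show ?thesis
  proof (rule wp_While_frame[where N = L and T = 24 and I = I])
    obtain e where "e < t" "q e = code (int B) m y\<^sub>0" using inv c(2) unfolding bfs_inv_def by auto
    then show "I 0 s" unfolding I_def using c x y0 by (auto intro!: exI[of _ e] exI[of _ y\<^sub>0])
  next
    fix k s' assume "I k s'" and fr: "agree_off backtrack_step s s'"
      and "bval (Neg (Equal (Reg ''c'') (Num 0))) s'"
    then obtain e y where x0: "\<forall>j. 0 \<le> mem s' ''x'' j" and e: "e + k < t" "q e = code (int B) m y" "reg s' ''c'' = q e"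
        "q e \<noteq> 0" and y: "\<forall>i<m. \<bar>y i\<bar> \<le> M" "\<forall>i<m. (\<Sum>j<n. a j i * mem s' ''x'' (int j)) + y i = y\<^sub>0 i"
      unfolding I_def by auto
    have "0 < e" using e inv by (cases "e = 0") (auto simp: bfs_inv_def)
    then obtain e' j where e': "e' < e" "j < n" "mem s ''par'' (q e) = int j + 1" "q e = q e' + code (int B) m (a j)"
      using inv e(1) unfolding bfs_inv_def by (meson add_lessD1)
    have "q e' \<in> code (int B) m ` Y" using inv e' e(1) unfolding bfs_inv_def by auto
    then obtain y' where y': "y' \<in> Y" "q e' = code (int B) m y'" by auto
    \<comment> \<open>The parent relation is known for codes only. Both sides differ by at most
      \<open>2 * M + D\<close>, which is less than \<open>B\<close>, so it carries over to the
      vectors.\<close>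
    have yy: "y i = y' i + a j i" if "i < m" for i
    proof (rule code_inject[of "int B" m y "\<lambda>i. y' i + a j i" i])
      show "code (int B) m y = code (int B) m (\<lambda>i. y' i + a j i)"
        using e e' y' by (simp add: code_add)
      show "\<bar>y i - (y' i + a j i)\<bar> < int B" if "i < m" for i
        using y(1) Y[OF y'(1) that] a_bound[OF that e'(2)] M that by fastforce
    qed (rule that)
    have eq: "mem s' ''par'' = mem s ''par''" "mem s' ''ca'' (int j) = code (int B) m (a j)"
      using fr ca[OF e'(2)] by (simp_all add: agree_off_def backtrack_step_def)
    define s'' where "s'' = s'\<lparr>reg := (reg s')(''j'' := int j, ''c'' := q e'),
      mem := (mem s')(''x'' := (mem s' ''x'')(int j := mem s' ''x'' (int j) + 1))\<rparr>"
    have "I (Suc k) s''"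
      unfolding I_def
    proof (intro conjI exI[of _ e'] exI[of _ y'])
      show "\<forall>j. 0 \<le> mem s'' ''x'' j" using x0 by (simp add: s''_def)
      show "e' + Suc k < t" using e(1) e'(1) by simp
      show "\<forall>i<m. (\<Sum>j<n. a j i * mem s'' ''x'' (int j)) + y' i = y\<^sub>0 i"
      proof (intro allI impI)
        fix i assume i: "i < m"
        have "(\<Sum>j<n. a j i * mem s'' ''x'' (int j)) = (\<Sum>j<n. a j i * mem s' ''x'' (int j)) + a j i"
          using sum_mult_update_Suc[OF e'(2), of "\<lambda>j. a j i" "mem s' ''x''"] by (simp add: s''_def)
        then show "(\<Sum>j<n. a j i * mem s'' ''x'' (int j)) + y' i = y\<^sub>0 i"
          using yy[OF i] y(2)[rule_format, OF i] by linarith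
      qed
    qed (use y' Y in \<open>auto simp: s''_def\<close>)
    moreover have "wp backtrack_step (\<lambda>t s'. t \<le> 24 \<and> s' = s'') s'"
      unfolding backtrack_step_def s''_def using e(3) e'(3,4) eq by simp
    ultimately show "k < L \<and> wp backtrack_step (\<lambda>t s'. t \<le> 24 \<and> I (Suc k) s') s'"
      using e(1) t by (auto elim: wp_mono)
  next
    fix u k s' assume u: "u \<le> L * (24 + 1 + bcost (Neg (Equal (Reg ''c'') (Num 0)))) + 1 + bcost (Neg (Equal (Reg ''c'') (Num 0)))"
      and "I k s'" and "\<not> bval (Neg (Equal (Reg ''c'') (Num 0))) s'"
    then obtain y where x0: "\<forall>j. 0 \<le> mem s' ''x'' j" and y: "code (int B) m y = 0" "\<forall>i<m. \<bar>y i\<bar> \<le> M"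
        "\<forall>i<m. (\<Sum>j<n. a j i * mem s' ''x'' (int j)) + y i = y\<^sub>0 i"
      unfolding I_def by auto
    have "y i = 0" if "i < m" for i using code_eq_0_imp[OF y(1) _ that] y(2) Bpos by fastforce
    then show "u \<le> L * 30 + 10 \<and> (\<forall>j. 0 \<le> mem s' ''x'' j) \<and>
      (\<forall>i<m. (\<Sum>j<n. a j i * mem s' ''x'' (int j)) = y\<^sub>0 i)"
      using u x0 y(3) by simp
  qed
qed

end

section \<open>Correctness and running time\<close>

definition solve :: com where
  "solve = one_norm ;; parameters ;; powers ;; column_codes ;; path ;; boxes ;; mark ;; bfs ;; backtrack"

context ilp
begin

text \<open>Coordinates from \<open>m\<close> on are unconstrained, which makes this set infinite;
  it is used through its finite image under \<open>code\<close>.\<close>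

definition tube :: "(nat \<Rightarrow> nat \<Rightarrow> int) \<Rightarrow> (nat \<Rightarrow> int) set" where
  "tube p = {y. \<exists>k<K. \<forall>i<m. \<bar>y i - p k i\<bar> \<le> int R}"

text \<open>Path points have entries below \<open>K\<close>: \<open>k * b i\<close> is at most
  \<open>K * (K - 1)\<close> in absolute value and the error is less than \<open>K\<close>, so
  \<open>p k i * K\<close> is less than \<open>K * K\<close>.\<close>

lemma tube_bounded:
  assumes p: "\<forall>k<K. \<forall>i<m. \<bar>int k * b i - p k i * int K\<bar> < int K" and "y \<in> tube p" and i: "i < m"
  shows "\<bar>y i\<bar> \<le> int (K + R)"
proof -
  obtain k where k: "k < K" "\<bar>y i - p k i\<bar> \<le> int R" using assms by (auto simp: tube_def)
  have "\<bar>int k * b i\<bar> \<le> int K * (int K - 1)"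
    unfolding abs_mult using k(1) b_less_K[OF i] by (intro mult_mono) auto
  moreover have "\<bar>int k * b i - p k i * int K\<bar> < int K" using p k(1) i by blast
  ultimately have "\<bar>p k i * int K\<bar> < int K * int K" by (simp add: algebra_simps)
  then have "\<bar>p k i\<bar> < int K" unfolding abs_mult using mult_right_less_imp_less by force
  then show ?thesis using k(2) by simp
qed

text \<open>Describing a box by its lowest corner and offsets between \<open>0\<close> and
  \<open>2 * R\<close>, instead of center and radius, gives the set that the machine
  enumerates.\<close>

lemma code_tube_iff:
  "c \<in> code (int B) m ` tube p \<longleftrightarrow>
    (\<exists>k<K. \<exists>e. (\<forall>i<m. 0 \<le> e i \<and> e i \<le> 2 * int R) \<and>
      c = code (int B) m (p k) - int R * (\<Sum>i<m. int B ^ i) + code (int B) m e)"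
proof -
  have off: "int R * (\<Sum>i<m. int B ^ i) = code (int B) m (\<lambda>_. int R)"
    by (simp add: code_def sum_distrib_left)
  show ?thesis
  proof
    assume "c \<in> code (int B) m ` tube p"
    then obtain y k where y: "c = code (int B) m y" "k < K" "\<forall>i<m. \<bar>y i - p k i\<bar> \<le> int R"
      unfolding tube_def by blast
    have "c = code (int B) m (p k) - int R * (\<Sum>i<m. int B ^ i) + code (int B) m (\<lambda>i. y i - p k i + int R)"
      using code_add[of "int B" m "\<lambda>i. y i - p k i" "\<lambda>_. int R"] code_diff[of "int B" m y "p k"] off y(1) by linarith
    moreover have "0 \<le> y i - p k i + int R \<and> y i - p k i + int R \<le> 2 * int R" if "i < m" for i
      using y(3)[rule_format, OF that] by linarith
    ultimately show "\<exists>k<K. \<exists>e. (\<forall>i<m. 0 \<le> e i \<and> e i \<le> 2 * int R) \<and>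
      c = code (int B) m (p k) - int R * (\<Sum>i<m. int B ^ i) + code (int B) m e"
      using y(2) by (intro exI[of _ k] exI[of _ "\<lambda>i. y i - p k i + int R"] conjI allI impI) simp_all
  next
    assume "\<exists>k<K. \<exists>e. (\<forall>i<m. 0 \<le> e i \<and> e i \<le> 2 * int R) \<and>
      c = code (int B) m (p k) - int R * (\<Sum>i<m. int B ^ i) + code (int B) m e"
    then obtain k e where e: "k < K" "\<forall>i<m. 0 \<le> e i \<and> e i \<le> 2 * int R"
      "c = code (int B) m (p k) - int R * (\<Sum>i<m. int B ^ i) + code (int B) m e" by blast
    have "c = code (int B) m (\<lambda>i. p k i - int R + e i)" 
      using code_add[of "int B" m "\<lambda>i. p k i - int R" e] code_diff[of "int B" m "p k" "\<lambda>_. int R"] off e(3) by linarith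
    moreover have "\<bar>p k i - int R + e i - p k i\<bar> \<le> int R" if "i < m" for i
      using e(2)[rule_format, OF that] by linarith
    then have "(\<lambda>i. p k i - int R + e i) \<in> tube p" using e(1) unfolding tube_def by blast
    ultimately show "c \<in> code (int B) m ` tube p" by (rule image_eqI)
  qed
qed

lemma near_segment_in_tube:
  assumes p: "\<forall>k<K. \<forall>i<m. \<bar>int k * b i - p k i * int K\<bar> < int K"
    and "0 \<le> \<theta>" "\<theta> \<le> 1"
    and "\<forall>i<m. \<bar>real_of_int (y i) - \<theta> * real_of_int (b i)\<bar> \<le> 2 * real m * real D"
  shows "y \<in> tube p"
proof -
  have "\<exists>k<K. \<forall>i<m. \<bar>y i - p k i\<bar> \<le> int (2 * m * D) + 2"
    using assms b_less_K by (intro near_segment_imp_near_lattice_path[of \<theta> K m y b]) (auto simp: K_def less_imp_le)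
  then show ?thesis by (simp add: tube_def R_def add.commute)
qed

text \<open>Induction along the Steinitz walk: the origin is visited, all prefixes lie in the tube,
  and the visited set is closed under column steps there. The argument runs on codes.\<close>

lemma solvable_imp_visited:
  assumes p: "\<forall>k<K. \<forall>i<m. \<bar>int k * b i - p k i * int K\<bar> < int K"
    and inv: "bfs_inv (code (int B) m ` tube p) (\<lambda>j. code (int B) m (a j)) n q t ok par"
    and closed: "\<forall>e<t. \<forall>j<n. q e + code (int B) m (a j) \<in> code (int B) m ` tube p \<longrightarrow>
      par (q e + code (int B) m (a j)) \<noteq> 0"
    and x: "\<And>i. i < m \<Longrightarrow> (\<Sum>j<n. a j i * int (x j)) = b i"
  shows "par (code (int B) m b) \<noteq> 0"
proof -
  obtain w where w: "set w \<subseteq> {..<n}" "\<forall>i<m. (\<Sum>j\<leftarrow>w. a j i) = b i"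
    and near: "\<And>l. \<exists>\<theta>\<ge>0. \<theta> \<le> 1 \<and> (\<forall>i<m. \<bar>real_of_int (\<Sum>j\<leftarrow>take l w. a j i) - \<theta> * real_of_int (b i)\<bar>
        \<le> 2 * real m * real_of_int (int D))"
    using exists_column_walk_near_segment[where m = m and n = n and a = a and b = b and x = x and D = "int D"] x a_bound by auto
  define y where "y l i = (\<Sum>j\<leftarrow>take l w. a j i)" for l i
  have tube: "y l \<in> tube p" for l
    using near[of l] near_segment_in_tube[OF p, of _ "y l"] by (auto simp: y_def)
  have "par (code (int B) m (y l)) \<noteq> 0" if "l \<le> length w" for l
    using that
  proof (induction l)
    case 0
    have "code (int B) m (y 0) = q 0" using inv by (simp add: y_def code_def bfs_inv_def)
    then show ?case using inv unfolding bfs_inv_def by auto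
  next
    case (Suc l)
    then obtain e where e: "e < t" "code (int B) m (y l) = q e" using inv unfolding bfs_inv_def by auto
    have "w ! l < n" using Suc.prems w(1) nth_mem[of l w] by (simp add: subset_iff)
    moreover have "y (Suc l) = (\<lambda>i. y l i + a (w ! l) i)"
      using Suc.prems by (simp add: y_def take_Suc_conv_app_nth fun_eq_iff)
    then have "code (int B) m (y (Suc l)) = q e + code (int B) m (a (w ! l))"
      using e(2) by (simp add: code_add)
    ultimately show ?case using closed e(1) tube[of "Suc l"] by (metis imageI)
  qed
  moreover have "code (int B) m (y (length w)) = code (int B) m b"
    using w(2) by (intro code_cong) (simp add: y_def)
  ultimately show ?thesis by (metis order_refl)
qed

definition answer :: "state \<Rightarrow> bool" where
  "answer s \<longleftrightarrow>
    reg s ''feasible'' = 1 \<and> (\<forall>j. 0 \<le> mem s ''x'' j) \<and>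
      (\<forall>i<m. (\<Sum>j<n. a j i * mem s ''x'' (int j)) = b i) \<or>
    reg s ''feasible'' = 0 \<and> (\<nexists>x :: nat \<Rightarrow> nat. \<forall>i<m. (\<Sum>j<n. a j i * int (x j)) = b i)"

lemma wp_backtrack:
  assumes p: "\<forall>k<K. \<forall>i<m. \<bar>int k * b i - p k i * int K\<bar> < int K"
    and inv: "bfs_inv (code (int B) m ` tube p) (\<lambda>j. code (int B) m (a j)) n q t ok (mem s ''par'')" and t: "t \<le> L"
    and closed: "\<forall>e<t. \<forall>j<n. q e + code (int B) m (a j) \<in> code (int B) m ` tube p \<longrightarrow>
      mem s ''par'' (q e + code (int B) m (a j)) \<noteq> 0"
    and c: "reg s ''c'' = code (int B) m b"
    and x: "mem s ''x'' = (\<lambda>_. 0)"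
    and ca: "\<And>j. j < n \<Longrightarrow> mem s ''ca'' (int j) = code (int B) m (a j)"
  shows "wp backtrack (\<lambda>u s'. u \<le> L * 30 + 20 \<and> answer s') s"
proof (cases "mem s ''par'' (code (int B) m b) = 0")
  case True
  then have "\<nexists>x :: nat \<Rightarrow> nat. \<forall>i<m. (\<Sum>j<n. a j i * int (x j)) = b i"
    using solvable_imp_visited[OF p inv closed] by blast
  then show ?thesis unfolding backtrack_def using True c by (simp add: answer_def)
next
  case False
  have "D \<le> m * D" using m by simp
  then have D_R: "D < R" unfolding R_def by linarith
  have loop: "wp (While (Neg (Equal (Reg ''c'') (Num 0))) backtrack_step) (\<lambda>u s'. u \<le> L * 30 + 10 \<and>
    (\<forall>j. 0 \<le> mem s' ''x'' j) \<and> (\<forall>i<m. (\<Sum>j<n. a j i * mem s' ''x'' (int j)) = b i)) s"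
  proof (rule wp_backtrack_loop[of "tube p" "int (K + R)"])
    show "\<bar>b i\<bar> \<le> int (K + R)" if "i < m" for i using b_less_K[OF that] by simp
    \<comment> \<open>The factor \<open>4\<close> in \<open>B\<close> is used here: two tube points
      account for \<open>2 * (K + R)\<close>, and \<open>D < R\<close> leaves room for a
      column.\<close>
    show "2 * int (K + R) + int D < int B" using D_R by (simp add: B_def)
  qed (use False inv t c x ca tube_bounded[OF p] in auto)
  show ?thesis
    unfolding backtrack_def using False c
    by (simp add: answer_def) (rule wp_mono[OF loop], auto)
qed

lemma wp_solve:
  assumes s: "reg s ''m'' = int m" "reg s ''n'' = int n" "reg s ''D'' = int D"
    and A: "\<And>k. k < m * n \<Longrightarrow> mem s ''A'' (int k) = A k"
    and b: "\<And>k. k < m \<Longrightarrow> mem s ''b'' (int k) = b k"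
    and zero: "\<And>r. r \<in> {''e'', ''ok'', ''par'', ''x''} \<Longrightarrow> mem s r = (\<lambda>_. 0)"
  shows "wp solve (\<lambda>t s'. t \<le> (30 * m + 20) + ((12 * m + 60) + ((m * (70 + 24 * B) + 20) +
    ((n * (40 + m * (12 * D + 40)) + 10) + ((K * (m * 54 + 34) + 10) +
    ((m * (80 + 12 * Q + 20 * (K * Q ^ m)) + 10) + ((K * Q ^ m * 20 + 10) +
    ((K * Q ^ m * (n * 50 + 16) + 30) + (K * Q ^ m * 30 + 20)))))))) \<and> answer s') s"
proof -
  note defs = agree_off_def one_norm_def one_norm_step_def parameters_def powers_def powers_step_def column_codes_def
    column_codes_step_def column_code_step_def path_def path_step_def path_coordinate_step_def boxes_def
    boxes_step_def fill_step_def mark_def mark_step_def bfs_def bfs_step_def bfs_edge_def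
  define L where "L = K * Q ^ m"
  \<comment> \<open>These facts survive every phase before backtracking. Below, the facts about each
    phase are stated twice: first its own result, then enriched by what it leaves unchanged.\<close>
  define s_ok where "s_ok s' \<longleftrightarrow> reg s' ''m'' = int m \<and> reg s' ''n'' = int n \<and> reg s' ''D'' = int D \<and>
    mem s' ''A'' = mem s ''A'' \<and> mem s' ''b'' = mem s ''b'' \<and> mem s' ''x'' = (\<lambda>_. 0)" for s' :: state
  have "s_ok s" using s zero by (simp add: s_ok_def)
  obtain t1 s1 where 1: "exec one_norm s t1 s1" "t1 \<le> 30 * m + 20" "reg s1 ''K'' = int K"
    using wp_one_norm[OF s(1) b] unfolding wp_def by blast
  have 1: "exec one_norm s t1 s1" "t1 \<le> 30 * m + 20" "reg s1 ''K'' = int K" "s_ok s1"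
    "mem s1 = mem s"
    using 1 exec_frame[OF 1(1)] \<open>s_ok s\<close> by (auto simp: defs s_ok_def fun_eq_iff)
  obtain t2 s2 where 2: "exec parameters s1 t2 s2" "t2 \<le> 12 * m + 60"
      "reg s2 ''R'' = int R" "reg s2 ''Q'' = int Q" "reg s2 ''B'' = int B"
    using wp_parameters[of s1] 1 unfolding wp_def s_ok_def by blast
  have 2: "exec parameters s1 t2 s2" "t2 \<le> 12 * m + 60" "reg s2 ''K'' = int K"
      "reg s2 ''R'' = int R" "reg s2 ''Q'' = int Q" "reg s2 ''B'' = int B" "s_ok s2" "mem s2 = mem s"
    using 2 1 exec_frame[OF 2(1)] by (auto simp: defs s_ok_def fun_eq_iff)
  obtain t3 s3 where 3: "exec powers s2 t3 s3" "t3 \<le> m * (70 + 24 * B) + 20"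
      "\<forall>i<m. mem s3 ''P'' (int i) = int B ^ i" "reg s3 ''off'' = int R * (\<Sum>i<m. int B ^ i)"
    using wp_powers[of s2] 2 unfolding wp_def s_ok_def by blast
  have 3: "exec powers s2 t3 s3" "t3 \<le> m * (70 + 24 * B) + 20"
      "\<And>i. i < m \<Longrightarrow> mem s3 ''P'' (int i) = int B ^ i" "reg s3 ''off'' = int R * (\<Sum>i<m. int B ^ i)"
      "reg s3 ''K'' = int K" "reg s3 ''Q'' = int Q" "s_ok s3"
      "mem s3 ''e'' = (\<lambda>_. 0)" "mem s3 ''ok'' = (\<lambda>_. 0)" "mem s3 ''par'' = (\<lambda>_. 0)"
    using 3 2 exec_frame[OF 3(1)] zero by (simp_all add: defs s_ok_def)
  obtain t4 s4 where 4: "exec column_codes s3 t4 s4" "t4 \<le> n * (40 + m * (12 * D + 40)) + 10"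
      "\<forall>j<n. mem s4 ''ca'' (int j) = code (int B) m (a j)"
    using wp_column_codes[of s3] 3 A unfolding wp_def s_ok_def by auto
  have 4: "exec column_codes s3 t4 s4" "t4 \<le> n * (40 + m * (12 * D + 40)) + 10"
      "\<And>j. j < n \<Longrightarrow> mem s4 ''ca'' (int j) = code (int B) m (a j)"
      "\<And>i. i < m \<Longrightarrow> mem s4 ''P'' (int i) = int B ^ i" "reg s4 ''off'' = int R * (\<Sum>i<m. int B ^ i)"
      "reg s4 ''K'' = int K" "reg s4 ''Q'' = int Q" "s_ok s4"
      "mem s4 ''e'' = (\<lambda>_. 0)" "mem s4 ''ok'' = (\<lambda>_. 0)" "mem s4 ''par'' = (\<lambda>_. 0)"
    using 4 3 exec_frame[OF 4(1)] by (simp_all add: defs s_ok_def)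
  obtain t5 s5 p where 5: "exec path s4 t5 s5" "t5 \<le> K * (m * 54 + 34) + 10" "reg s5 ''c'' = code (int B) m b"
      and p: "\<forall>k<K. \<forall>i<m. \<bar>int k * b i - p k i * int K\<bar> < int K"
      and l: "\<forall>k<K. mem s5 ''l'' (int k) = code (int B) m (p k) - int R * (\<Sum>i<m. int B ^ i)"
    using wp_path[of s4 "int R * (\<Sum>i<m. int B ^ i)"] 4 b unfolding wp_def s_ok_def by auto
  have 5: "exec path s4 t5 s5" "t5 \<le> K * (m * 54 + 34) + 10" "reg s5 ''c'' = code (int B) m b"
      "\<And>j. j < n \<Longrightarrow> mem s5 ''ca'' (int j) = code (int B) m (a j)"
      "\<And>i. i < m \<Longrightarrow> mem s5 ''P'' (int i) = int B ^ i"
      "reg s5 ''K'' = int K" "reg s5 ''Q'' = int Q" "s_ok s5"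
      "mem s5 ''ok'' = (\<lambda>_. 0)" "mem s5 ''par'' = (\<lambda>_. 0)"
    using 5 4 exec_frame[OF 5(1)] by (simp_all add: defs s_ok_def)
  obtain t6 s6 where 6: "exec boxes s5 t6 s6" "t6 \<le> m * (80 + 12 * Q + 20 * L) + 10"
      "reg s6 ''L'' = int L"
      and l6: "\<forall>c. (\<exists>k<L. mem s6 ''l'' (int k) = c) \<longleftrightarrow>
      (\<exists>k<K. \<exists>e. (\<forall>i<m. 0 \<le> e i \<and> e i \<le> 2 * int R) \<and>
        c = mem s5 ''l'' (int k) + code (int B) m e)"
    using wp_boxes[of s5] 5 unfolding wp_def s_ok_def L_def by auto
  have 6: "exec boxes s5 t6 s6" "t6 \<le> m * (80 + 12 * Q + 20 * L) + 10" "reg s6 ''L'' = int L"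
      "reg s6 ''c'' = code (int B) m b"
      "\<And>j. j < n \<Longrightarrow> mem s6 ''ca'' (int j) = code (int B) m (a j)"
      "s_ok s6" "mem s6 ''ok'' = (\<lambda>_. 0)" "mem s6 ''par'' = (\<lambda>_. 0)"
    using 6 5 exec_frame[OF 6(1)] by (simp_all add: defs s_ok_def)
  define S where "S = code (int B) m ` tube p"
  have S_iff: "(\<exists>k<L. mem s6 ''l'' (int k) = c) \<longleftrightarrow> c \<in> S" for c
  proof -
    have "(\<exists>k<L. mem s6 ''l'' (int k) = c) \<longleftrightarrow>
      (\<exists>k<K. \<exists>e. (\<forall>i<m. 0 \<le> e i \<and> e i \<le> 2 * int R) \<and>
        c = mem s5 ''l'' (int k) + code (int B) m e)" using l6 by blast
    also have "\<dots> \<longleftrightarrow> c \<in> S"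
      unfolding S_def code_tube_iff using l by (intro ex_cong1 conj_cong refl) simp
    finally show ?thesis .
  qed
  have S_eq: "S = (\<lambda>k. mem s6 ''l'' (int k)) ` {..<L}"
    unfolding set_eq_iff image_iff by (auto simp flip: S_iff)
  have "0 \<in> S"
  proof -
    have "(\<lambda>_. 0) \<in> tube p" by (rule near_segment_in_tube[OF p, of 0]) auto
    then show ?thesis unfolding S_def by (force simp: code_def)
  qed
  have card_S: "finite S" "card S \<le> L"
    unfolding S_eq using card_image_le[of "{..<L}"] by auto
  obtain t7 s7 where 7: "exec mark s6 t7 s7" "t7 \<le> L * 20 + 10"
      "\<forall>c. mem s7 ''ok'' c = (if \<exists>k<L. mem s6 ''l'' (int k) = c then 1 else 0)"
    using wp_mark[of s6 L] 6 unfolding wp_def by auto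
  have 7: "exec mark s6 t7 s7" "t7 \<le> L * 20 + 10" "\<And>c. mem s7 ''ok'' c = (if c \<in> S then 1 else 0)"
      "reg s7 ''c'' = code (int B) m b"
      "\<And>j. j < n \<Longrightarrow> mem s7 ''ca'' (int j) = code (int B) m (a j)" "s_ok s7" "mem s7 ''par'' = (\<lambda>_. 0)"
    using 7 6 exec_frame[OF 7(1)] unfolding S_iff by (simp_all add: defs s_ok_def)
  obtain t8 s8 q t where 8: "exec bfs s7 t8 s8" "t8 \<le> L * (n * 50 + 16) + 30" "t \<le> L"
      "bfs_inv S (\<lambda>j. code (int B) m (a j)) n q t (mem s8 ''ok'') (mem s8 ''par'')"
      "\<forall>e<t. \<forall>j<n. q e + code (int B) m (a j) \<in> S \<longrightarrow> mem s8 ''par'' (q e + code (int B) m (a j)) \<noteq> 0"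
    using wp_bfs[of s7 n "\<lambda>j. code (int B) m (a j)" S L] 7 card_S \<open>0 \<in> S\<close> unfolding wp_def s_ok_def by auto
  have s8: "reg s8 ''c'' = code (int B) m b" "mem s8 ''x'' = (\<lambda>_. 0)"
      "\<And>j. j < n \<Longrightarrow> mem s8 ''ca'' (int j) = code (int B) m (a j)"
    using 7 exec_frame[OF 8(1)] by (simp_all add: defs s_ok_def)
  obtain t9 s9 where 9: "exec backtrack s8 t9 s9" "t9 \<le> L * 30 + 20" "answer s9"
    using wp_backtrack[OF p 8(4)[unfolded S_def] 8(3) 8(5)[unfolded S_def] s8] unfolding wp_def by blast
  have "exec solve s (t1 + (t2 + (t3 + (t4 + (t5 + (t6 + (t7 + (t8 + t9)))))))) s9"
    unfolding solve_def using 1(1) 2(1) 3(1) 4(1) 5(1) 6(1) 7(1) 8(1) 9(1) by (intro exec.Seq)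
  moreover note 1(2) 2(2) 3(2) 4(2) 5(2) 6(2) 7(2) 8(2) 9(2,3)
  ultimately show ?thesis unfolding wp_def L_def
    by (intro exI[of _ "t1 + (t2 + (t3 + (t4 + (t5 + (t6 + (t7 + (t8 + t9)))))))"] exI[of _ s9] conjI add_mono) auto
qed

text \<open>Every parameter is at most linear in \<open>L = K * Q ^ m\<close>: \<open>K\<close>,
  \<open>Q\<close> and \<open>m * D\<close> are at most \<open>L\<close>, and \<open>B\<close> is at
  most \<open>8 * L\<close>. So even the products by repeated addition fit into multiples of
  \<open>m * n * L\<close>.\<close>

lemma time_bound:
  "(12 * m + 50 * (m * n) + 50) + ((30 * m + 20) + ((12 * m + 60) + ((m * (70 + 24 * B) + 20) +
    ((n * (40 + m * (12 * D + 40)) + 10) + ((K * (m * 54 + 34) + 10) +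
    ((m * (80 + 12 * Q + 20 * (K * Q ^ m)) + 10) + ((K * Q ^ m * 20 + 10) +
    ((K * Q ^ m * (n * 50 + 16) + 30) + (K * Q ^ m * 30 + 20))))))))) \<le> 2000 * (m * n * (K * Q ^ m))"
proof -
  define L where "L = K * Q ^ m"
  define X where "X = m * n * L"
  have K: "1 \<le> K" and Q: "1 \<le> Q" by (simp_all add: K_def Q_def)
  have "Q ^ 1 \<le> Q ^ m" using Q m by (intro power_increasing) auto
  then have QL: "Q \<le> L" using mult_mono[OF K, of Q "Q ^ m"] by (simp add: L_def)
  have KL: "K \<le> L" using Q by (simp add: L_def)
  have BL: "B \<le> 8 * L" using QL KL by (simp add: B_def Q_def)
  have mDL: "m * D \<le> L" using QL by (simp add: Q_def R_def)
  have X: "u * v * w \<le> X" if "u \<le> m" "v \<le> n" "w \<le> L" for u v w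
    unfolding X_def using that by (intro mult_mono) auto
  have one: "1 \<le> m" "1 \<le> n" "1 \<le> L" using m n QL Q by auto
  have "1 \<le> X" "m \<le> X" "n \<le> X" "m * n \<le> X" "L \<le> X" "m * L \<le> X" "n * L \<le> X"
      "K \<le> X" "m * K \<le> X" "m * Q \<le> X" "n * (m * D) \<le> X"
    using X[of 1 1 1] X[of m 1 1] X[of 1 n 1] X[of m n 1] X[of 1 1 L] X[of m 1 L] X[of 1 n L]
      X[of 1 1 K] X[of m 1 K] X[of m 1 Q] X[of 1 n "m * D"] one KL QL mDL by auto
  moreover have "m * B \<le> 8 * X" using mult_le_mono2[OF BL, of m] \<open>m * L \<le> X\<close> by linarith
  ultimately show ?thesis unfolding L_def[symmetric] X_def[symmetric]
    by (simp add: algebra_simps)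
qed

end

section \<open>Transfer to matrices and the explicit constant\<close>

lemma feasible_solution_iff:
  assumes "A \<in> carrier_mat m n" and "b \<in> carrier_vec m"
  shows "feasible_solution A b (vec n x) \<longleftrightarrow>
    (\<forall>j<n. 0 \<le> x j) \<and> (\<forall>i<m. (\<Sum>j<n. A $$ (i, j) * x j) = b $ i)"
proof -
  have "(A *\<^sub>v vec n x) $ i = (\<Sum>j<n. A $$ (i, j) * x j)" if "i < m" for i
    using assms that by (simp add: scalar_prod_def atLeast0LessThan)
  then show ?thesis
    using assms unfolding feasible_solution_def vec_eq_iff less_eq_vec_def by auto
qed

text \<open>The stray factor \<open>m\<close> disappears in the power by
  \<open>m \<le> 2 ^ m\<close>, which gives \<open>4000 * m \<le> 8000 ^ m\<close>; then
  \<open>72000 = 8000 * 9\<close>.\<close>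

lemma ilp_cost_bound:
  fixes m n K Q :: nat and \<Delta> \<beta> :: real
  assumes "0 < m" and "1 \<le> \<Delta>" and "real Q \<le> 9 * (real m * \<Delta>)" and "real K \<le> 2 * \<beta>"
  shows "real (2000 * (m * n * (K * Q ^ m))) \<le> (72000 * (real m * \<Delta>)) ^ m * \<beta> * real n"
proof -
  have m2: "real m \<le> 2 ^ m" using of_nat_less_two_power[of m, where 'a = real] by simp
  have "(4000 :: real) ^ 1 \<le> 4000 ^ m" using assms(1) by (intro power_increasing) auto
  then have "4000 * real m \<le> 4000 ^ m * 2 ^ m" using m2 by (intro mult_mono) auto
  then have c: "4000 * real m \<le> 8000 ^ m" by (simp flip: power_mult_distrib)
  define Z where "Z = (9 * (real m * \<Delta>)) ^ m"
  have Z: "real Q ^ m \<le> Z" "0 \<le> Z" unfolding Z_def using assms(2,3) by (intro power_mono zero_le_power; simp)+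
  have \<beta>: "0 \<le> \<beta>" using assms(4) by simp
  have "real (2000 * (m * n * (K * Q ^ m))) = 2000 * real m * (real K * real Q ^ m) * real n" by simp
  also have "\<dots> \<le> 2000 * real m * ((2 * \<beta>) * Z) * real n"
    using Z assms(4) \<beta> by (intro mult_right_mono mult_left_mono mult_mono) auto
  also have "\<dots> = (4000 * real m) * (Z * \<beta> * real n)" by simp
  also have "\<dots> \<le> 8000 ^ m * (Z * \<beta> * real n)"
    using c Z \<beta> by (intro mult_right_mono) auto
  also have "\<dots> = (8000 * (9 * (real m * \<Delta>))) ^ m * \<beta> * real n"
    unfolding Z_def power_mult_distrib[of 8000] by (simp only: mult.assoc)
  also have "8000 * (9 * (real m * \<Delta>)) = 72000 * (real m * \<Delta>)" by simp
  finally show ?thesis .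
qed

text \<open>Program and constant are chosen before the instance. The maxima with \<open>1\<close>
  cover \<open>b = 0\<close> and the zero matrix, where the plain product can be \<open>0\<close>
  although every run takes time.\<close>

theorem theorem2:
  shows "\<exists>(P :: com) (C :: real). C > 0 \<and>
    (\<forall>(m :: nat) (n :: nat) (A :: int mat) (b :: int vec) (\<Delta> :: real).
       0 < m \<longrightarrow> 0 < n \<longrightarrow> A \<in> carrier_mat m n \<longrightarrow> b \<in> carrier_vec m \<longrightarrow>
       (\<forall>i<m. \<forall>j<n. real_of_int \<bar>A $$ (i, j)\<bar> \<le> \<Delta>) \<longrightarrow>
       (\<exists>t s. exec P (initial_state A b) t s \<and> correct_answer A b s \<and>
          real t \<le> (C * (real m * max 1 \<Delta>)) ^ m * max 1 (real_of_int (l1_norm b)) * real n))"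
proof (intro exI[of _ "max_entry ;; solve"] exI[of _ "72000 :: real"] conjI allI impI)
  fix m n :: nat and A :: "int mat" and b :: "int vec" and \<Delta> :: real
  assume m: "0 < m" and n: "0 < n" and A: "A \<in> carrier_mat m n" and b: "b \<in> carrier_vec m"
    and \<Delta>: "\<forall>i<m. \<forall>j<n. real_of_int \<bar>A $$ (i, j)\<bar> \<le> \<Delta>"
  define F where "F k = A $$ (k div n, k mod n)" for k
  have F: "F (i * n + j) = A $$ (i, j)" if "j < n" for i j using that by (simp add: F_def)
  let ?s = "initial_state A b"
  have s: "reg ?s ''m'' = int m" "reg ?s ''n'' = int n"
      "\<And>k. k < m * n \<Longrightarrow> mem ?s ''A'' (int k) = F k" "\<And>k. k < m \<Longrightarrow> mem ?s ''b'' (int k) = b $ k"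
      "\<And>r. r \<in> {''e'', ''ok'', ''par'', ''x''} \<Longrightarrow> mem ?s r = (\<lambda>_. 0)"
    using A b by (auto simp: initial_state_def F_def simp flip: of_nat_mult)
  obtain t1 s1 where 1: "exec max_entry ?s t1 s1" "t1 \<le> 12 * m + 50 * (m * n) + 50" "1 \<le> reg s1 ''D''"
      "\<forall>k<m * n. \<bar>F k\<bar> \<le> reg s1 ''D''" "reg s1 ''D'' = 1 \<or> (\<exists>k<m * n. reg s1 ''D'' = \<bar>F k\<bar>)"
    using wp_max_entry[of ?s m n F] s unfolding wp_def by blast
  define D where "D = nat (reg s1 ''D'')"
  have D_reg: "reg s1 ''D'' = int D" using 1(3) by (simp add: D_def)
  have "real D \<le> max 1 \<Delta>"
    using 1(5)
  proof
    assume "\<exists>k<m * n. reg s1 ''D'' = \<bar>F k\<bar>"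
    then obtain k where k: "k < m * n" "int D = \<bar>F k\<bar>" using D_reg by auto
    have "k div n < m" "k mod n < n" using k(1) n by (simp_all add: less_mult_imp_div_less)
    then have "real_of_int \<bar>F k\<bar> \<le> \<Delta>" using \<Delta> by (simp add: F_def)
    then show ?thesis by (simp flip: k(2))
  qed (simp add: D_def)
  interpret ilp m n D F "\<lambda>i. b $ i"
    using m n 1(3,4) D_reg by unfold_locales auto
  have s1: "reg s1 ''m'' = int m" "reg s1 ''n'' = int n" "mem s1 = mem ?s"
    using exec_frame[OF 1(1)] s by (auto simp: max_entry_def max_entry_step_def fun_eq_iff)
  obtain t2 s2 where 2: "exec solve s1 t2 s2" "answer s2"
      and time: "t2 \<le> (30 * m + 20) + ((12 * m + 60) + ((m * (70 + 24 * B) + 20) +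
        ((n * (40 + m * (12 * D + 40)) + 10) + ((K * (m * 54 + 34) + 10) +
        ((m * (80 + 12 * Q + 20 * (K * Q ^ m)) + 10) + ((K * Q ^ m * 20 + 10) +
        ((K * Q ^ m * (n * 50 + 16) + 30) + (K * Q ^ m * 30 + 20))))))))"
    using wp_solve[OF s1(1,2) D_reg] s s1(3) unfolding wp_def by auto
  have total: "t1 + t2 \<le> 2000 * (m * n * (K * Q ^ m))"
    by (rule order_trans[OF add_mono[OF 1(2) time] time_bound])
  have a_eq: "(\<Sum>j<n. a j i * x j) = (\<Sum>j<n. A $$ (i, j) * x j)" for i and x :: "nat \<Rightarrow> int"
    by (intro sum.cong) (simp_all add: a_def F)
  have "correct_answer A b s2"
    using 2(2) unfolding answer_def
  proof
    assume h: "reg s2 ''feasible'' = 1 \<and> (\<forall>j. 0 \<le> mem s2 ''x'' j) \<and>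
      (\<forall>i<m. (\<Sum>j<n. a j i * mem s2 ''x'' (int j)) = b $ i)"
    then show ?thesis
      using A feasible_solution_iff[OF A b] by (simp add: correct_answer_def output_vec_def a_eq)
  next
    assume h: "reg s2 ''feasible'' = 0 \<and> (\<nexists>x :: nat \<Rightarrow> nat. \<forall>i<m. (\<Sum>j<n. a j i * int (x j)) = b $ i)"
    have False if "feasible_solution A b x" for x
    proof -
      have "x = vec n (($) x)" using that A by (auto simp: feasible_solution_def vec_eq_iff)
      then have x: "(\<forall>j<n. 0 \<le> x $ j) \<and> (\<forall>i<m. (\<Sum>j<n. A $$ (i, j) * x $ j) = b $ i)"
        using that feasible_solution_iff[OF A b, of "($) x"] by simp
      then have "(\<Sum>j<n. a j i * int (nat (x $ j))) = (\<Sum>j<n. A $$ (i, j) * x $ j)" for i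
        unfolding a_eq by (intro sum.cong) auto
      then have "\<forall>i<m. (\<Sum>j<n. a j i * int (nat (x $ j))) = b $ i" using x by simp
      then have "\<exists>x :: nat \<Rightarrow> nat. \<forall>i<m. (\<Sum>j<n. a j i * int (x j)) = b $ i"
        by (rule exI[of _ "\<lambda>j. nat (x $ j)"])
      with h show False by simp
    qed
    with h show ?thesis by (auto simp: correct_answer_def)
  qed
  moreover have "exec (max_entry ;; solve) ?s (t1 + t2) s2" using 1(1) 2(1) by (rule exec.Seq)
  moreover have "real (t1 + t2) \<le> (72000 * (real m * max 1 \<Delta>)) ^ m * max 1 (real_of_int (l1_norm b)) * real n"
  proof -
    have "real m * real D \<le> real m * max 1 \<Delta>" using \<open>real D \<le> max 1 \<Delta>\<close> by (intro mult_left_mono) auto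
    moreover have "1 * 1 \<le> real m * max 1 \<Delta>" using m by (intro mult_mono) auto
    \<comment> \<open>Here \<open>Q = 4 * m * D + 5\<close>, and the \<open>5\<close> is absorbed
      because \<open>m * max 1 \<Delta>\<close> is at least \<open>1\<close>.\<close>
    ultimately have "real Q \<le> 9 * (real m * max 1 \<Delta>)" by (simp add: Q_def R_def)
    moreover have "real K \<le> 2 * max 1 (real_of_int (l1_norm b))"
    proof -
      have "int K = 1 + l1_norm b" using b by (simp add: K_def l1_norm_def)
      then have "real K = 1 + real_of_int (l1_norm b)" by (metis of_int_1 of_int_add of_int_of_nat_eq)
      then show ?thesis by simp
    qed
    ultimately have "real (2000 * (m * n * (K * Q ^ m)))
        \<le> (72000 * (real m * max 1 \<Delta>)) ^ m * max 1 (real_of_int (l1_norm b)) * real n"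
      using m by (intro ilp_cost_bound) auto
    moreover have "real (t1 + t2) \<le> real (2000 * (m * n * (K * Q ^ m)))" using total by (rule of_nat_mono)
    ultimately show ?thesis by linarith
  qed
  ultimately show "\<exists>t s. exec (max_entry ;; solve) ?s t s \<and> correct_answer A b s \<and>
      real t \<le> (72000 * (real m * max 1 \<Delta>)) ^ m * max 1 (real_of_int (l1_norm b)) * real n"
    by blast
qed simp

end
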